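(* Let $q,v\in(-1,1)$ and $t,w$ be real with $|q|\le t\le 1$, $|v|\le w\le 1$, and let $\xi\in H_{\mathbb R}$, $\eta\in\bar H_{\mathbb R}$ with $\|\xi\otimes\eta\|=1$. Then the probability distribution of the quadrabasic Gaussian operator $G_{\xi\otimes\eta}=\mathbf A_{\xi\otimes\eta}+\mathbf A^*_{\xi\otimes\eta}$ with respect to the vacuum state $\varphi$ is equal to $\mu_{q,t,v,w}$, the probability measure orthogonalizing the polynomials defined by $Q_{-1}(x)=0$, $Q_0(x)=1$ and $$xQ_n(x)=Q_{n+1}(x)+[n]_{q,t}[n]_{v,w}\,Q_{n-1}(x),\qquad n=0,1,2,\dots$$
   Context: Convention: $0^0=1$. $[n]_{q,t}=\sum_{k=0}^{n-1}q^{k}t^{n-1-k}$ for $n\ge1$ (and similarly $[n]_{v,w}$). $H$ and $\bar H$ are two separable complex Hilbert spaces, complexifications of real Hilbert spaces $H_{\mathbb R},\bar H_{\mathbb R}$; inner products are linear in the second variable. ($\bar H$ is just the name of a second space.) For $n\ge 1$ define on $H^{\otimes n}$ $$P^{(n)}_{q,t}(\eta_1\otimes\cdots\otimes\eta_n)=\sum_{\sigma\in S_n}q^{l_1(\sigma)}t^{\binom n2-l_1(\sigma)}\,\eta_{\sigma(1)}\otimes\cdots\otimes\eta_{\sigma(n)},$$ where $l_1(\sigma)$ is the number of inversions of $\sigma$, and $P^{(0)}_{q,t}=I$ on $\mathbb C\Omega$. Define $P^{(n)}_{v,w}$ on $\bar H^{\otimes n}$ in the same way (vacuum vector $\bar\Omega$).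 The algebraic diagonal Fock space is $\mathcal F_{\rm dig}=\bigoplus_{n\ge0}H^{\otimes n}\otimes\bar H^{\otimes n}$ (finite sums), with $n=0$ term $\mathbb C\,\Omega\otimes\bar\Omega$. It carries the positive semi-definite sesquilinear form $\langle f,g\rangle_{q,t,v,w}=\delta_{n,m}\langle f,(P^{(n)}_{q,t}\otimes P^{(n)}_{v,w})g\rangle$ for $f$ in degree $m$, $g$ in degree $n$, where the right-hand inner product is the usual one. The quadrabasic Fock space is the completion of $\mathcal F_{\rm dig}$ (after dividing by the kernel of the form if necessary). For $\xi\in H_{\mathbb R}$: $a^*_{q,t}(\xi)\Omega=\xi$, $a^*_{q,t}(\xi)\eta_1\otimes\cdots\otimes\eta_n=\xi\otimes\eta_1\otimes\cdots\otimes\eta_n$, $a_{q,t}(\xi)\Omega=0$, $a_{q,t}(\xi)\eta_1\otimes\cdots\otimes\eta_n=\sum_{i=1}^nq^{i-1}t^{n-i}\langle\xi,\eta_i\rangle\,\eta_1\otimes\cdots\otimes\hat\eta_i\otimes\cdots\otimes\eta_n$ (hat means omission). Similarly for $a_{v,w},a^*_{v,w}$ over $\bar H$. For $\xi\in H_{\mathbb R}$, $\eta\in\bar H_{\mathbb R}$ put $\mathbf A_{\xi\otimes\eta}=a_{q,t}(\xi)\otimes a_{v,w}(\eta)$ and $\mathbf A^*_{\xi\otimes\eta}=a^*_{q,t}(\xi)\otimes a^*_{v,w}(\eta)$, acting on $\mathcal F_{\rm dig}$; these are adjoint to each other and bounded when $|q|,|v|<1$. The vacuum state is $\varphi(\cdot)=\langle\Omega\otimes\bar\Omega,\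 \cdot\ \Omega\otimes\bar\Omega\rangle_{q,t,v,w}$. The distribution of a bounded self-adjoint operator $G$ with respect to $\varphi$ is the compactly supported probability measure $\kappa$ on $\mathbb R$ with $\varphi(G^n)=\int x^n\,d\kappa(x)$ for all $n\ge0$. "$\mu$ orthogonalizes $(Q_n)$" means $\int Q_mQ_n\,d\mu=\delta_{m,n}\prod_{k=1}^n[k]_{q,t}[k]_{v,w}$. *)

theory Defs
  imports
    "HOL-Probability.Probability"
    "HOL-Combinatorics.Permutations"
    "HOL-Computational_Algebra.Polynomial"
    "HOL-Library.Function_Algebras"
begin

section \<open>Complexification of a real Hilbert space\<close>

text \<open>
  The complexification of a real Hilbert space \<open>'h\<close> is \<open>'h \<times> 'h\<close>, where \<open>(a, b)\<close> stands for
  \<open>a + i b\<close>.  The library's addition and norm on the product are those of the complexification;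
  the complex scalar multiplication and the inner product (linear in the second variable) are
  given here.
\<close>

type_synonym 'h cplx = "'h \<times> 'h"

definition cscale :: "complex \<Rightarrow> 'h::real_inner cplx \<Rightarrow> 'h cplx" where
  "cscale c x = (Re c *\<^sub>R fst x - Im c *\<^sub>R snd x, Im c *\<^sub>R fst x + Re c *\<^sub>R snd x)"

definition cinner :: "'h::real_inner cplx \<Rightarrow> 'h cplx \<Rightarrow> complex" where
  "cinner x y = Complex (inner (fst x) (fst y) + inner (snd x) (snd y))
                        (inner (fst x) (snd y) - inner (snd x) (fst y))"

definition of_re :: "'h::real_inner \<Rightarrow> 'h cplx" where
  "of_re \<xi> = (\<xi>, 0)"

lemma cinner_commute: "cinner y x = cnj (cinner x y)"
  by (simp add: cinner_def complex_eq_iff inner_commute)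

lemma cinner_add_right: "cinner x (y + z) = cinner x y + cinner x z"
  by (simp add: cinner_def complex_eq_iff inner_add_right)

lemma cinner_scale_right: "cinner x (cscale c y) = c * cinner x y"
  by (simp add: cinner_def cscale_def complex_eq_iff inner_add_right inner_diff_right algebra_simps)

lemma cinner_self: "cinner x x = of_real ((norm x)\<^sup>2)"
  by (simp add: cinner_def complex_eq_iff norm_prod_def power2_norm_eq_inner inner_commute)


section \<open>Tensors\<close>

text \<open>
  As in Reed and Simon, the elementary tensor \<open>\<eta>\<^sub>1 \<otimes> \<dots> \<otimes> \<eta>\<^sub>n\<close> is realised as the conjugate-multilinear
  functional \<open>(x\<^sub>1, \<dots>, x\<^sub>n) \<mapsto> \<langle>x\<^sub>1, \<eta>\<^sub>1\<rangle> \<cdots> \<langle>x\<^sub>n, \<eta>\<^sub>n\<rangle>\<close>, and the algebraic tensor power as the complex span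
  of these functionals.  A function on lists collects one functional for each degree
  \<open>n = length xs\<close>, so the span of all elementary tensors is the algebraic direct sum of the
  tensor powers.
\<close>

definition etensor :: "'h::real_inner cplx list \<Rightarrow> 'h cplx list \<Rightarrow> complex" where
  "etensor \<eta>s xs =
     (if length xs = length \<eta>s then \<Prod>i<length \<eta>s. cinner (xs ! i) (\<eta>s ! i) else 0)"

definition fun_tensor :: "('a \<Rightarrow> complex) \<Rightarrow> ('b \<Rightarrow> complex) \<Rightarrow> 'a \<Rightarrow> 'b \<Rightarrow> complex" where
  "fun_tensor f g xs ys = f xs * g ys"

text \<open>
  For \<open>F = (\<Sum>i. f\<^sub>i \<otimes> g\<^sub>i)\<close> and linear \<open>S\<close> and \<open>T\<close> this is \<open>(\<Sum>i. S f\<^sub>i \<otimes> T g\<^sub>i)\<close>; see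
  \<open>op_tensor_fun_tensor\<close> below.
\<close>

definition op_tensor ::
  "(('a \<Rightarrow> complex) \<Rightarrow> 'c \<Rightarrow> complex) \<Rightarrow> (('b \<Rightarrow> complex) \<Rightarrow> 'd \<Rightarrow> complex) \<Rightarrow>
   ('a \<Rightarrow> 'b \<Rightarrow> complex) \<Rightarrow> 'c \<Rightarrow> 'd \<Rightarrow> complex" where
  "op_tensor S T F xs ys = S (\<lambda>xs'. T (F xs') ys) xs"

definition scale1 :: "complex \<Rightarrow> ('a \<Rightarrow> complex) \<Rightarrow> 'a \<Rightarrow> complex" where
  "scale1 c f = (\<lambda>x. c * f x)"

definition scale2 :: "complex \<Rightarrow> ('a \<Rightarrow> 'b \<Rightarrow> complex) \<Rightarrow> 'a \<Rightarrow> 'b \<Rightarrow> complex" where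
  "scale2 c F = (\<lambda>x y. c * F x y)"

global_interpretation fun1: vector_space scale1
  by standard (simp_all add: fun_eq_iff scale1_def distrib_left distrib_right mult.assoc)

global_interpretation fun2: vector_space scale2
  by standard (simp_all add: fun_eq_iff scale2_def distrib_left distrib_right mult.assoc)

definition is_linear :: "(('a \<Rightarrow> complex) \<Rightarrow> 'b \<Rightarrow> complex) \<Rightarrow> bool" where
  "is_linear S \<longleftrightarrow>
     (\<forall>f g. S (f + g) = S f + S g) \<and> (\<forall>c f. S (scale1 c f) = scale1 c (S f))"

lemma op_tensor_fun_tensor:
  assumes "is_linear S" "is_linear T"
  shows "op_tensor S T (fun_tensor f g) = fun_tensor (S f) (T g)"
proof -
  have "fun_tensor f g xs = scale1 (f xs) g" for xs
    by (simp add: fun_eq_iff fun_tensor_def scale1_def)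
  then have T: "T (fun_tensor f g xs) = scale1 (f xs) (T g)" for xs
    using assms(2) by (simp add: is_linear_def)
  have "(\<lambda>xs. scale1 (f xs) (T g) ys) = scale1 (T g ys) f" for ys
    by (simp add: fun_eq_iff scale1_def)
  then show ?thesis
    using assms(1) by (simp add: fun_eq_iff op_tensor_def T is_linear_def fun_tensor_def)
      (simp add: scale1_def)
qed


section \<open>Operators on one tensor algebra\<close>

definition inversions :: "nat \<Rightarrow> (nat \<Rightarrow> nat) \<Rightarrow> nat" where
  "inversions n \<sigma> = card {(i, j). i < j \<and> j < n \<and> \<sigma> i > \<sigma> j}"

text \<open>
  These operators are given by their action on functionals; the lemmas after them give the
  familiar formulas on elementary tensors.  In \<open>annih\<close> the functional is evaluated with
  \<open>\<xi>\<close> inserted at position \<open>i\<close> (counted from 0); the degree of \<open>f\<close> is \<open>n = length xs + 1\<close>.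
\<close>

definition sym_op :: "real \<Rightarrow> real \<Rightarrow> ('h cplx list \<Rightarrow> complex) \<Rightarrow> 'h cplx list \<Rightarrow> complex" where
  "sym_op q t f xs =
     (let n = length xs in
      \<Sum>\<sigma> | \<sigma> permutes {..<n}.
        of_real (q ^ inversions n \<sigma> * t ^ ((n choose 2) - inversions n \<sigma>)) *
        f (map (\<lambda>i. xs ! inv \<sigma> i) [0..<n]))"

definition creat ::
  "'h::real_inner \<Rightarrow> ('h cplx list \<Rightarrow> complex) \<Rightarrow> 'h cplx list \<Rightarrow> complex" where
  "creat \<xi> f xs = (case xs of [] \<Rightarrow> 0 | y # ys \<Rightarrow> cinner y (of_re \<xi>) * f ys)"

definition annih ::
  "real \<Rightarrow> real \<Rightarrow> 'h::real_inner \<Rightarrow> ('h cplx list \<Rightarrow> complex) \<Rightarrow> 'h cplx list \<Rightarrow> complex" where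
  "annih q t \<xi> f xs =
     (\<Sum>i<Suc (length xs). of_real (q ^ i * t ^ (length xs - i)) *
        f (take i xs @ of_re \<xi> # drop i xs))"

lemma is_linear_sym_op: "is_linear (sym_op q t)"
  unfolding is_linear_def scale1_def sym_op_def Let_def fun_eq_iff plus_fun_apply sum.distrib[symmetric]
    sum_distrib_left by (intro conjI allI sum.cong refl) (simp_all only: distrib_left mult.left_commute)

lemma is_linear_creat: "is_linear (creat \<xi>)"
  by (auto simp: is_linear_def scale1_def creat_def fun_eq_iff algebra_simps split: list.split)

lemma is_linear_annih: "is_linear (annih q t \<xi>)"
  unfolding is_linear_def scale1_def annih_def fun_eq_iff plus_fun_apply sum.distrib[symmetric]
    sum_distrib_left by (intro conjI allI sum.cong refl) (simp_all only: distrib_left mult.left_commute)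

lemma sym_op_etensor:
  fixes \<eta>s :: "'h::real_inner cplx list"
  defines "n \<equiv> length \<eta>s"
  shows "sym_op q t (etensor \<eta>s) =
    (\<lambda>xs. \<Sum>\<sigma> | \<sigma> permutes {..<n}.
       of_real (q ^ inversions n \<sigma> * t ^ ((n choose 2) - inversions n \<sigma>)) *
       etensor (map (\<lambda>i. \<eta>s ! \<sigma> i) [0..<n]) xs)"
proof (rule ext)
  fix xs :: "'h cplx list"
  show "sym_op q t (etensor \<eta>s) xs = (\<Sum>\<sigma> | \<sigma> permutes {..<n}.
       of_real (q ^ inversions n \<sigma> * t ^ ((n choose 2) - inversions n \<sigma>)) *
       etensor (map (\<lambda>i. \<eta>s ! \<sigma> i) [0..<n]) xs)"
  proof (cases "length xs = n")
    case True
    have "etensor \<eta>s (map (\<lambda>i. xs ! inv \<sigma> i) [0..<n]) = etensor (map (\<lambda>i. \<eta>s ! \<sigma> i) [0..<n]) xs"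
      if p: "\<sigma> permutes {..<n}" for \<sigma>
    proof -
      have "(\<Prod>i<n. cinner (xs ! inv \<sigma> i) (\<eta>s ! i)) = (\<Prod>i<n. cinner (xs ! inv \<sigma> (\<sigma> i)) (\<eta>s ! \<sigma> i))"
        by (rule prod.permute[OF p, unfolded comp_def])
      also have "\<dots> = (\<Prod>i<n. cinner (xs ! i) (\<eta>s ! \<sigma> i))"
        by (simp add: permutes_inverses[OF p])
      finally show ?thesis using True by (simp add: etensor_def n_def)
    qed
    then show ?thesis using True by (simp add: sym_op_def)
  next
    case False
    then show ?thesis by (simp add: sym_op_def etensor_def n_def Let_def)
  qed
qed

lemma creat_etensor: "creat \<xi> (etensor \<eta>s) = etensor (of_re \<xi> # \<eta>s)"
  by (auto simp: fun_eq_iff creat_def etensor_def prod.lessThan_Suc_shift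
      simp del: prod.lessThan_Suc split: list.split)

lemma annih_etensor_Nil: "annih q t \<xi> (etensor []) = 0"
  by (simp add: fun_eq_iff annih_def etensor_def)

lemma etensor_insert:
  assumes "length xs = m" "length \<eta>s = Suc m" "i \<le> m"
  shows "etensor \<eta>s (take i xs @ y # drop i xs) =
           cinner y (\<eta>s ! i) * etensor (take i \<eta>s @ drop (Suc i) \<eta>s) xs"
proof -
  have split: "(\<Prod>k<Suc m. h k) = h i * (\<Prod>k<m. h (if k < i then k else Suc k))"
    for h :: "nat \<Rightarrow> complex"
  proof -
    have eq: "{..<Suc m} = insert i ((\<lambda>k. if k < i then k else Suc k) ` {..<m})"
    proof (rule set_eqI)
      fix x
      show "x \<in> {..<Suc m} \<longleftrightarrow> x \<in> insert i ((\<lambda>k. if k < i then k else Suc k) ` {..<m})"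
        using assms(3)
        by (cases x i rule: linorder_cases) (auto simp: image_iff intro: bexI[of _ "x - 1"])
    qed
    have ni: "i \<notin> (\<lambda>k. if k < i then k else Suc k) ` {..<m}" by auto
    have inj: "inj_on (\<lambda>k. if k < i then k else Suc k) {..<m}"
      by (auto simp: inj_on_def split: if_splits)
    have "(\<Prod>k\<in>insert i ((\<lambda>k. if k < i then k else Suc k) ` {..<m}). h k) =
        h i * (\<Prod>k\<in>(\<lambda>k. if k < i then k else Suc k) ` {..<m}. h k)"
      using ni by (intro prod.insert) auto
    also have "\<dots> = h i * (\<Prod>k<m. h (if k < i then k else Suc k))"
      by (subst prod.reindex[OF inj]) (simp add: comp_def)
    finally show ?thesis unfolding eq .
  qed
  have "etensor \<eta>s (take i xs @ y # drop i xs) =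
      (\<Prod>k<Suc m. cinner ((take i xs @ y # drop i xs) ! k) (\<eta>s ! k))"
    using assms by (simp add: etensor_def)
  also have "\<dots> = cinner y (\<eta>s ! i) *
      (\<Prod>k<m. cinner (xs ! k) ((take i \<eta>s @ drop (Suc i) \<eta>s) ! k))"
    unfolding split using assms
    by (intro arg_cong2[of _ _ _ _ "(*)"] prod.cong) (auto simp: nth_append min_def)
  also have "\<dots> = cinner y (\<eta>s ! i) * etensor (take i \<eta>s @ drop (Suc i) \<eta>s) xs"
    using assms by (simp add: etensor_def)
  finally show ?thesis .
qed

lemma annih_etensor:
  fixes \<eta>s :: "'h::real_inner cplx list"
  defines "n \<equiv> length \<eta>s"
  shows "annih q t \<xi> (etensor \<eta>s) =
    (\<lambda>xs. \<Sum>i<n. of_real (q ^ i * t ^ (n - 1 - i)) * cinner (of_re \<xi>) (\<eta>s ! i) *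
            etensor (take i \<eta>s @ drop (Suc i) \<eta>s) xs)"
proof (rule ext)
  fix xs :: "'h cplx list"
  show "annih q t \<xi> (etensor \<eta>s) xs =
    (\<Sum>i<n. of_real (q ^ i * t ^ (n - 1 - i)) * cinner (of_re \<xi>) (\<eta>s ! i) *
            etensor (take i \<eta>s @ drop (Suc i) \<eta>s) xs)"
  proof (cases "n = Suc (length xs)")
    case True
    have "etensor \<eta>s (take i xs @ of_re \<xi> # drop i xs) =
        cinner (of_re \<xi>) (\<eta>s ! i) * etensor (take i \<eta>s @ drop (Suc i) \<eta>s) xs" if "i < n" for i
      using that True by (intro etensor_insert[of _ "length xs"]) (auto simp: n_def)
    then show ?thesis
      unfolding annih_def True[symmetric]
      by (intro sum.cong refl) (simp add: True mult.assoc)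
  next
    case False
    have "etensor \<eta>s (take i xs @ of_re \<xi> # drop i xs) = 0" if "i < Suc (length xs)" for i
    proof -
      have "length (take i xs @ of_re \<xi> # drop i xs) = Suc (length xs)" using that by simp
      moreover have "Suc (length xs) \<noteq> length \<eta>s" using False by (simp add: n_def)
      ultimately show ?thesis by (simp only: etensor_def if_False)
    qed
    then have "annih q t \<xi> (etensor \<eta>s) xs = 0"
      unfolding annih_def by (intro sum.neutral ballI) (simp only: lessThan_iff mult_zero_right)
    moreover have "etensor (take i \<eta>s @ drop (Suc i) \<eta>s) xs = 0" if "i < n" for i
    proof -
      have "length (take i \<eta>s @ drop (Suc i) \<eta>s) = n - 1" using that by (simp add: n_def)
      moreover have "length xs \<noteq> n - 1" using that False by simp
      ultimately show ?thesis by (simp only: etensor_def if_False)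
    qed
    ultimately show ?thesis by simp
  qed
qed


section \<open>The algebraic diagonal Fock space\<close>

definition dig_set :: "('h::real_inner cplx list \<Rightarrow> 'k::real_inner cplx list \<Rightarrow> complex) set" where
  "dig_set = fun2.span {fun_tensor (etensor \<eta>s) (etensor \<zeta>s) | \<eta>s \<zeta>s. length \<eta>s = length \<zeta>s}"

typedef (overloaded) ('h::real_inner, 'k::real_inner) fock_dig =
  "dig_set :: ('h cplx list \<Rightarrow> 'k cplx list \<Rightarrow> complex) set"
  morphisms functional Abs_fock_dig
  unfolding dig_set_def using fun2.span_zero by blast

setup_lifting type_definition_fock_dig

instantiation fock_dig :: (real_inner, real_inner) ab_group_add
begin

lift_definition zero_fock_dig :: "('a, 'b) fock_dig" is 0
  unfolding dig_set_def by (rule fun2.span_zero)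
lift_definition plus_fock_dig :: "('a, 'b) fock_dig \<Rightarrow> ('a, 'b) fock_dig \<Rightarrow> ('a, 'b) fock_dig" is "(+)"
  unfolding dig_set_def by (rule fun2.span_add)
lift_definition minus_fock_dig :: "('a, 'b) fock_dig \<Rightarrow> ('a, 'b) fock_dig \<Rightarrow> ('a, 'b) fock_dig" is "(-)"
  unfolding dig_set_def by (rule fun2.span_diff)
lift_definition uminus_fock_dig :: "('a, 'b) fock_dig \<Rightarrow> ('a, 'b) fock_dig" is "uminus"
  unfolding dig_set_def by (rule fun2.span_neg)

instance
  by standard (transfer; simp add: fun_eq_iff)+

end

lift_definition fscale ::
  "complex \<Rightarrow> ('h::real_inner, 'k::real_inner) fock_dig \<Rightarrow> ('h, 'k) fock_dig"
  is scale2
  unfolding dig_set_def by (rule fun2.span_scale)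

lift_definition elem_tensor ::
  "'h::real_inner cplx list \<Rightarrow> 'k::real_inner cplx list \<Rightarrow> ('h, 'k) fock_dig"
  is "\<lambda>\<eta>s \<zeta>s. if length \<eta>s = length \<zeta>s then fun_tensor (etensor \<eta>s) (etensor \<zeta>s) else 0"
  unfolding dig_set_def by (auto intro: fun2.span_base fun2.span_zero)

definition vacuum :: "('h::real_inner, 'k::real_inner) fock_dig" where
  "vacuum = elem_tensor [] []"

lemma fock_dig_induct [case_names zero step]:
  assumes "P 0" and "\<And>c \<eta>s \<zeta>s f. P f \<Longrightarrow> length \<eta>s = length \<zeta>s \<Longrightarrow> P (fscale c (elem_tensor \<eta>s \<zeta>s) + f)"
  shows "P f"
proof -
  have "\<exists>g. functional g = F \<and> P g" if "F \<in> dig_set" for F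
    using that unfolding dig_set_def
  proof (induction rule: fun2.span_induct_alt)
    case base
    show ?case by (rule exI[of _ 0]) (simp add: assms(1) zero_fock_dig.rep_eq)
  next
    case (step c x y)
    then obtain \<eta>s \<zeta>s g where *: "x = fun_tensor (etensor \<eta>s) (etensor \<zeta>s)" "length \<eta>s = length \<zeta>s"
      "functional g = y" "P g" by blast
    then show ?case
      by (intro exI[of _ "fscale c (elem_tensor \<eta>s \<zeta>s) + g"])
        (simp add: assms(2) plus_fock_dig.rep_eq fscale.rep_eq scale2_def elem_tensor.rep_eq)
  qed
  from this[OF functional[of f]] show ?thesis
    by (auto simp: functional_inject)
qed


subsection \<open>The usual inner product\<close>

text \<open>
  Evaluating the functional of \<open>g\<close> at \<open>(\<eta>s, \<zeta>s)\<close> gives the inner product of the elementary tensor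
  of \<open>(\<eta>s, \<zeta>s)\<close> with \<open>g\<close>.  This is extended antilinearly in the first variable; it does not depend
  on the chosen decomposition of \<open>f\<close> (\<open>fock_inner_sum_list\<close>).
\<close>

definition fock_inner ::
  "('h::real_inner, 'k::real_inner) fock_dig \<Rightarrow> ('h, 'k) fock_dig \<Rightarrow> complex" where
  "fock_inner f g = (THE z. \<forall>L. f = (\<Sum>(c, \<eta>s, \<zeta>s)\<leftarrow>L. fscale c (elem_tensor \<eta>s \<zeta>s)) \<longrightarrow>
                              z = (\<Sum>(c, \<eta>s, \<zeta>s)\<leftarrow>L. cnj c * functional g \<eta>s \<zeta>s))"

definition fock_norm :: "('h::real_inner, 'k::real_inner) fock_dig \<Rightarrow> real" where
  "fock_norm f = sqrt (Re (fock_inner f f))"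

lemma etensor_commute: "etensor xs ys = cnj (etensor ys xs)"
  by (auto simp: etensor_def intro!: prod.cong cinner_commute)

lemma etensor_eq_0: "length xs \<noteq> length \<eta>s \<Longrightarrow> etensor \<eta>s xs = 0"
  by (simp add: etensor_def)

lemma functional_elem_commute:
  "functional (elem_tensor \<eta>s \<zeta>s) xs ys = cnj (functional (elem_tensor xs ys) \<eta>s \<zeta>s)"
proof (cases "length \<eta>s = length xs \<and> length \<zeta>s = length ys")
  case True
  then show ?thesis
    using etensor_commute[of \<eta>s xs] etensor_commute[of \<zeta>s ys]
    by (simp add: elem_tensor.rep_eq fun_tensor_def)
next
  case False
  then show ?thesis
    by (auto simp: elem_tensor.rep_eq fun_tensor_def etensor_eq_0)
qed

lemma functional_sum_list:
  "functional (\<Sum>(c, \<eta>s, \<zeta>s)\<leftarrow>L. fscale c (elem_tensor \<eta>s \<zeta>s)) xs ys =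
     (\<Sum>(c, \<eta>s, \<zeta>s)\<leftarrow>L. c * functional (elem_tensor \<eta>s \<zeta>s) xs ys)"
  by (induction L) (auto simp: zero_fock_dig.rep_eq plus_fock_dig.rep_eq fscale.rep_eq scale2_def)

lemma sum_list_functional_unique:
  assumes "(\<Sum>(c, \<eta>s, \<zeta>s)\<leftarrow>L. fscale c (elem_tensor \<eta>s \<zeta>s)) = (\<Sum>(c, \<eta>s, \<zeta>s)\<leftarrow>L'. fscale c (elem_tensor \<eta>s \<zeta>s))"
  shows "(\<Sum>(c, \<eta>s, \<zeta>s)\<leftarrow>L. cnj c * functional g \<eta>s \<zeta>s) =
         (\<Sum>(c, \<eta>s, \<zeta>s)\<leftarrow>L'. cnj c * functional g \<eta>s \<zeta>s)"
proof (induction g rule: fock_dig_induct)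
  case zero
  have "(\<Sum>(c, \<eta>s, \<zeta>s)\<leftarrow>L. cnj c * functional 0 \<eta>s \<zeta>s) = 0" for L
    by (induction L) (auto simp: zero_fock_dig.rep_eq)
  then show ?case by metis
next
  case (step d xs ys g)
  have *: "(\<Sum>(c, \<eta>s, \<zeta>s)\<leftarrow>M. cnj c * functional (fscale d (elem_tensor xs ys) + g) \<eta>s \<zeta>s) =
    d * cnj (functional (\<Sum>(c, \<eta>s, \<zeta>s)\<leftarrow>M. fscale c (elem_tensor \<eta>s \<zeta>s)) xs ys) +
    (\<Sum>(c, \<eta>s, \<zeta>s)\<leftarrow>M. cnj c * functional g \<eta>s \<zeta>s)" for M
  proof (induction M)
    case (Cons a M)
    obtain c \<eta>s \<zeta>s where a: "a = (c, \<eta>s, \<zeta>s)" by (cases a)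
    show ?case using Cons unfolding a
      by (simp add: plus_fock_dig.rep_eq fscale.rep_eq scale2_def functional_elem_commute[of \<eta>s \<zeta>s xs ys]
          algebra_simps)
  qed (simp add: zero_fock_dig.rep_eq)
  show ?case unfolding * using step assms by simp
qed

lemma ex_sum_list: "\<exists>L. f = (\<Sum>(c, \<eta>s, \<zeta>s)\<leftarrow>L. fscale c (elem_tensor \<eta>s \<zeta>s))"
proof (induction f rule: fock_dig_induct)
  case zero
  show ?case by (rule exI[of _ "[]"]) simp
next
  case (step c \<eta>s \<zeta>s f)
  then obtain L where "f = (\<Sum>(c, \<eta>s, \<zeta>s)\<leftarrow>L. fscale c (elem_tensor \<eta>s \<zeta>s))" by blast
  then show ?case by (intro exI[of _ "(c, \<eta>s, \<zeta>s) # L"]) simp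
qed

lemma fock_inner_sum_list:
  "fock_inner (\<Sum>(c, \<eta>s, \<zeta>s)\<leftarrow>L. fscale c (elem_tensor \<eta>s \<zeta>s)) g =
     (\<Sum>(c, \<eta>s, \<zeta>s)\<leftarrow>L. cnj c * functional g \<eta>s \<zeta>s)"
  unfolding fock_inner_def
  by (rule the_equality) (blast intro: sum_list_functional_unique)+

lemma fock_inner_elem_left: "fock_inner (elem_tensor \<eta>s \<zeta>s) g = functional g \<eta>s \<zeta>s"
proof -
  have "fscale 1 (elem_tensor \<eta>s \<zeta>s) = elem_tensor \<eta>s \<zeta>s" by transfer (simp add: fun_eq_iff scale2_def)
  then show ?thesis using fock_inner_sum_list[of "[(1, \<eta>s, \<zeta>s)]" g] by simp
qed

lemma fock_inner_elem:
  assumes "length \<eta>s = length \<zeta>s" "length xs = length ys"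
  shows "fock_inner (elem_tensor xs ys) (elem_tensor \<eta>s \<zeta>s) =
    (if length xs = length \<eta>s
     then (\<Prod>i<length xs. cinner (xs ! i) (\<eta>s ! i)) * (\<Prod>i<length ys. cinner (ys ! i) (\<zeta>s ! i))
     else 0)"
  using assms by (auto simp: fock_inner_elem_left elem_tensor.rep_eq fun_tensor_def etensor_def)

lemma fock_inner_add_left: "fock_inner (f + f') g = fock_inner f g + fock_inner f' g"
proof -
  obtain L L' where L: "f = (\<Sum>(c, \<eta>s, \<zeta>s)\<leftarrow>L. fscale c (elem_tensor \<eta>s \<zeta>s))"
    "f' = (\<Sum>(c, \<eta>s, \<zeta>s)\<leftarrow>L'. fscale c (elem_tensor \<eta>s \<zeta>s))"
    using ex_sum_list[of f] ex_sum_list[of f'] by blast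
  show ?thesis using fock_inner_sum_list[of "L @ L'" g] by (simp add: L fock_inner_sum_list)
qed

lemma fock_inner_scale_left: "fock_inner (fscale d f) g = cnj d * fock_inner f g"
proof -
  obtain L where L: "f = (\<Sum>(c, \<eta>s, \<zeta>s)\<leftarrow>L. fscale c (elem_tensor \<eta>s \<zeta>s))" using ex_sum_list[of f] by blast
  let ?L = "map (\<lambda>(c, \<eta>s, \<zeta>s). (d * c, \<eta>s, \<zeta>s)) L"
  have add: "fscale d (a + b) = fscale d a + fscale d b"
    and mult: "fscale d (fscale c a) = fscale (d * c) a"
    and zero: "fscale d 0 = 0" for a b :: "('a, 'b) fock_dig" and c
    by (transfer; simp add: fun_eq_iff scale2_def algebra_simps)+
  have "fscale d f = (\<Sum>(c, \<eta>s, \<zeta>s)\<leftarrow>?L. fscale c (elem_tensor \<eta>s \<zeta>s))"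
    unfolding L by (induction L) (auto simp: add mult zero)
  then have "fock_inner (fscale d f) g = (\<Sum>(c, \<eta>s, \<zeta>s)\<leftarrow>?L. cnj c * functional g \<eta>s \<zeta>s)"
    by (simp only: fock_inner_sum_list)
  also have "\<dots> = cnj d * (\<Sum>(c, \<eta>s, \<zeta>s)\<leftarrow>L. cnj c * functional g \<eta>s \<zeta>s)"
    by (induction L) (auto simp: algebra_simps)
  finally show ?thesis by (simp add: L fock_inner_sum_list)
qed

lemma fock_inner_add_right: "fock_inner f (g + g') = fock_inner f g + fock_inner f g'"
proof -
  obtain L where L: "f = (\<Sum>(c, \<eta>s, \<zeta>s)\<leftarrow>L. fscale c (elem_tensor \<eta>s \<zeta>s))" using ex_sum_list[of f] by blast
  show ?thesis unfolding L fock_inner_sum_list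
    by (induction L) (auto simp: plus_fock_dig.rep_eq algebra_simps)
qed

lemma fock_inner_scale_right: "fock_inner f (fscale d g) = d * fock_inner f g"
proof -
  obtain L where L: "f = (\<Sum>(c, \<eta>s, \<zeta>s)\<leftarrow>L. fscale c (elem_tensor \<eta>s \<zeta>s))" using ex_sum_list[of f] by blast
  show ?thesis unfolding L fock_inner_sum_list
    by (induction L) (auto simp: fscale.rep_eq scale2_def algebra_simps)
qed


lemma fock_norm_elem_tensor: "fock_norm (elem_tensor [x] [y]) = norm x * norm y"
proof -
  have "fock_inner (elem_tensor [x] [y]) (elem_tensor [x] [y]) = of_real ((norm x * norm y)\<^sup>2)"
    by (simp add: fock_inner_elem cinner_self power_mult_distrib)
  then show ?thesis by (simp only: fock_norm_def Re_complex_of_real) simp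
qed


subsection \<open>Operators on the diagonal Fock space\<close>

text \<open>
  \<open>shifts d d'\<close>: linear maps sending degree \<open>n\<close> into degree \<open>n + d - d'\<close>.  The truncated
  subtraction is harmless, since annihilation sends degree 0 to 0 (\<open>annih_etensor_Nil\<close>).
\<close>

definition deg_span :: "nat \<Rightarrow> ('h::real_inner cplx list \<Rightarrow> complex) set" where
  "deg_span n = fun1.span {etensor \<eta>s | \<eta>s. length \<eta>s = n}"

definition shifts ::
  "nat \<Rightarrow> nat \<Rightarrow> (('h::real_inner cplx list \<Rightarrow> complex) \<Rightarrow> 'h cplx list \<Rightarrow> complex) \<Rightarrow> bool" where
  "shifts d d' S \<longleftrightarrow> is_linear S \<and> (\<forall>\<eta>s. S (etensor \<eta>s) \<in> deg_span (length \<eta>s + d - d'))"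

lemma fun_tensor_0: "fun_tensor 0 g = 0" "fun_tensor f 0 = 0"
  by (simp_all add: fun_eq_iff fun_tensor_def)

lemma fun_tensor_dig_set:
  assumes "f \<in> deg_span n" "g \<in> deg_span n"
  shows "fun_tensor f g \<in> dig_set"
  using assms(1) unfolding deg_span_def
proof (induction rule: fun1.span_induct_alt)
  case base
  show ?case unfolding dig_set_def by (simp only: fun_tensor_0 fun2.span_zero)
next
  case (step c x y)
  then obtain \<eta>s where x: "x = etensor \<eta>s" "length \<eta>s = n" by blast
  have "fun_tensor x g \<in> dig_set"
    using assms(2) unfolding deg_span_def
  proof (induction rule: fun1.span_induct_alt)
    case base
    show ?case unfolding dig_set_def by (simp only: fun_tensor_0 fun2.span_zero)
  next
    case (step d x' y')
    then obtain \<zeta>s where x': "x' = etensor \<zeta>s" "length \<zeta>s = n" by blast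
    have "fun_tensor x (scale1 d x' + y') =
        scale2 d (fun_tensor x x') + fun_tensor x y'"
      by (simp add: fun_eq_iff fun_tensor_def scale1_def scale2_def algebra_simps)
    moreover have "fun_tensor x x' \<in> dig_set"
      unfolding dig_set_def x(1) x'(1)
      by (rule fun2.span_base, rule CollectI, intro exI conjI, rule refl) (simp add: x(2) x'(2))
    ultimately show ?case using step unfolding dig_set_def
      by (metis (no_types, lifting) fun2.span_add fun2.span_scale)
  qed
  moreover have "fun_tensor (scale1 c x + y) g =
      scale2 c (fun_tensor x g) + fun_tensor y g"
    by (simp add: fun_eq_iff fun_tensor_def scale1_def scale2_def algebra_simps)
  ultimately show ?case using step unfolding dig_set_def
    by (metis (no_types, lifting) fun2.span_add fun2.span_scale)
qed

lemma op_tensor_dig_set: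
  assumes S: "shifts d d' S" and T: "shifts d d' T" and F: "F \<in> dig_set"
  shows "op_tensor S T F \<in> dig_set"
proof -
  have lin: "is_linear S" "is_linear T" using S T by (auto simp: shifts_def)
  have add: "op_tensor S T (F + G) = op_tensor S T F + op_tensor S T G" for F G
  proof (intro ext)
    fix xs ys
    have "(\<lambda>xs'. T ((F + G) xs') ys) = (\<lambda>xs'. T (F xs') ys) + (\<lambda>xs'. T (G xs') ys)"
      using lin(2) by (auto simp: is_linear_def fun_eq_iff)
    then show "op_tensor S T (F + G) xs ys = (op_tensor S T F + op_tensor S T G) xs ys"
      using lin(1) by (simp add: op_tensor_def is_linear_def)
  qed
  have scale: "op_tensor S T (scale2 c F) = scale2 c (op_tensor S T F)" for c F
  proof (intro ext)
    fix xs ys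
    have row: "scale2 c F xs' = scale1 c (F xs')" for xs'
      by (simp add: fun_eq_iff scale1_def scale2_def)
    have "(\<lambda>xs'. T (scale2 c F xs') ys) = scale1 c (\<lambda>xs'. T (F xs') ys)"
      using lin(2) by (simp add: row is_linear_def) (simp add: scale1_def)
    then show "op_tensor S T (scale2 c F) xs ys = scale2 c (op_tensor S T F) xs ys"
      using lin(1) by (simp add: op_tensor_def is_linear_def) (simp add: op_tensor_def scale1_def scale2_def)
  qed
  show ?thesis
    using F[unfolded dig_set_def]
  proof (induction rule: fun2.span_induct_alt)
    case base
    have "op_tensor S T 0 = 0" using scale[of 0 0] by simp
    then show ?case unfolding dig_set_def by (simp only: fun2.span_zero)
  next
    case (step c x y)
    then obtain \<eta>s \<zeta>s where x: "x = fun_tensor (etensor \<eta>s) (etensor \<zeta>s)" "length \<eta>s = length \<zeta>s"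
      by blast
    have "op_tensor S T x = fun_tensor (S (etensor \<eta>s)) (T (etensor \<zeta>s))"
      by (simp add: x op_tensor_fun_tensor lin)
    also have "\<dots> \<in> dig_set"
    proof (rule fun_tensor_dig_set)
      show "S (etensor \<eta>s) \<in> deg_span (length \<eta>s + d - d')"
        using S by (simp add: shifts_def)
      show "T (etensor \<zeta>s) \<in> deg_span (length \<eta>s + d - d')"
        using T x(2) by (simp add: shifts_def)
    qed
    finally show ?case using step
      unfolding add scale dig_set_def by (intro fun2.span_add fun2.span_scale)
  qed
qed

lemma deg_span_sum:
  assumes "\<And>i. i \<in> I \<Longrightarrow> length (E i) = n"
  shows "(\<lambda>xs. \<Sum>i\<in>I. c i * etensor (E i) xs) \<in> deg_span n"
proof -
  have "(\<lambda>xs. \<Sum>i\<in>I. c i * etensor (E i) xs) = (\<Sum>i\<in>I. scale1 (c i) (etensor (E i)))"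
    by (induction I rule: infinite_finite_induct) (auto simp: fun_eq_iff scale1_def)
  also have "\<dots> \<in> deg_span n"
    unfolding deg_span_def
    by (intro fun1.span_sum fun1.span_scale fun1.span_base) (use assms in auto)
  finally show ?thesis .
qed

lemma shifts_sym_op: "shifts 0 0 (sym_op q t)"
  by (auto simp: shifts_def is_linear_sym_op sym_op_etensor intro!: deg_span_sum)

lemma shifts_creat: "shifts 1 0 (creat \<xi>)"
  by (auto simp: shifts_def is_linear_creat creat_etensor deg_span_def intro!: fun1.span_base)

lemma shifts_annih: "shifts 0 1 (annih q t \<xi>)"
  unfolding shifts_def annih_etensor
  by (auto simp: is_linear_annih min_def intro!: deg_span_sum)

lift_definition sym_dig ::
  "real \<Rightarrow> real \<Rightarrow> real \<Rightarrow> real \<Rightarrow> ('h::real_inner, 'k::real_inner) fock_dig \<Rightarrow> ('h, 'k) fock_dig"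
  is "\<lambda>q t v w. op_tensor (sym_op q t) (sym_op v w)"
  by (rule op_tensor_dig_set[OF shifts_sym_op shifts_sym_op])

lift_definition annih_dig ::
  "real \<Rightarrow> real \<Rightarrow> real \<Rightarrow> real \<Rightarrow> 'h \<Rightarrow> 'k \<Rightarrow>
   ('h::real_inner, 'k::real_inner) fock_dig \<Rightarrow> ('h, 'k) fock_dig"
  is "\<lambda>q t v w \<xi> \<eta>. op_tensor (annih q t \<xi>) (annih v w \<eta>)"
  by (rule op_tensor_dig_set[OF shifts_annih shifts_annih])

lift_definition creat_dig ::
  "'h \<Rightarrow> 'k \<Rightarrow> ('h::real_inner, 'k::real_inner) fock_dig \<Rightarrow> ('h, 'k) fock_dig"
  is "\<lambda>\<xi> \<eta>. op_tensor (creat \<xi>) (creat \<eta>)"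
  by (rule op_tensor_dig_set[OF shifts_creat shifts_creat])

definition gauss_op ::
  "real \<Rightarrow> real \<Rightarrow> real \<Rightarrow> real \<Rightarrow> 'h \<Rightarrow> 'k \<Rightarrow>
   ('h::real_inner, 'k::real_inner) fock_dig \<Rightarrow> ('h, 'k) fock_dig" where
  "gauss_op q t v w \<xi> \<eta> f = annih_dig q t v w \<xi> \<eta> f + creat_dig \<xi> \<eta> f"

text \<open>
  The factor \<open>\<delta>\<^bsub>n,m\<^esub>\<close> of the quadrabasic form is built in: \<open>fock_inner\<close> makes different degrees
  orthogonal and \<open>sym_dig\<close> preserves the degree.
\<close>

definition quad_form ::
  "real \<Rightarrow> real \<Rightarrow> real \<Rightarrow> real \<Rightarrow>
   ('h::real_inner, 'k::real_inner) fock_dig \<Rightarrow> ('h, 'k) fock_dig \<Rightarrow> complex" where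
  "quad_form q t v w f g = fock_inner f (sym_dig q t v w g)"

definition vacuum_state ::
  "real \<Rightarrow> real \<Rightarrow> real \<Rightarrow> real \<Rightarrow>
   (('h::real_inner, 'k::real_inner) fock_dig \<Rightarrow> ('h, 'k) fock_dig) \<Rightarrow> complex" where
  "vacuum_state q t v w T = quad_form q t v w vacuum (T vacuum)"


section \<open>Distributions and orthogonal polynomials\<close>

text \<open>
  The vacuum lies in the algebraic Fock space, and the operators considered here map that space to
  itself, so the vacuum moments of their bounded extensions to the completion are computed there.
\<close>

definition is_vacuum_distribution ::
  "real \<Rightarrow> real \<Rightarrow> real \<Rightarrow> real \<Rightarrow>
   (('h::real_inner, 'k::real_inner) fock_dig \<Rightarrow> ('h, 'k) fock_dig) \<Rightarrow> real measure \<Rightarrow> bool" where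
  "is_vacuum_distribution q t v w G \<kappa> \<longleftrightarrow>
     real_distribution \<kappa> \<and>
     (\<exists>K. compact K \<and> (AE x in \<kappa>. x \<in> K)) \<and>
     (\<forall>n. vacuum_state q t v w (G ^^ n) = of_real (\<integral>x. x ^ n \<partial>\<kappa>))"

definition vacuum_distribution ::
  "real \<Rightarrow> real \<Rightarrow> real \<Rightarrow> real \<Rightarrow>
   (('h::real_inner, 'k::real_inner) fock_dig \<Rightarrow> ('h, 'k) fock_dig) \<Rightarrow> real measure" where
  "vacuum_distribution q t v w G = (THE \<kappa>. is_vacuum_distribution q t v w G \<kappa>)"

definition qt_num :: "nat \<Rightarrow> real \<Rightarrow> real \<Rightarrow> real" where
  "qt_num n q t = (\<Sum>k<n. q ^ k * t ^ (n - 1 - k))"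

text \<open>\<open>quad_poly_shifted q t v w (n + 1)\<close> is the polynomial of index \<open>n\<close>, for \<open>n = -1, 0, 1, \<dots>\<close>\<close>

fun quad_poly_shifted :: "real \<Rightarrow> real \<Rightarrow> real \<Rightarrow> real \<Rightarrow> nat \<Rightarrow> real poly" where
  "quad_poly_shifted q t v w 0 = 0"
| "quad_poly_shifted q t v w (Suc 0) = 1"
| "quad_poly_shifted q t v w (Suc (Suc n)) =
     [:0, 1:] * quad_poly_shifted q t v w (Suc n) -
     smult (qt_num n q t * qt_num n v w) (quad_poly_shifted q t v w n)"

definition quad_poly :: "real \<Rightarrow> real \<Rightarrow> real \<Rightarrow> real \<Rightarrow> nat \<Rightarrow> real poly" where
  "quad_poly q t v w n = quad_poly_shifted q t v w (Suc n)"

definition orthogonalizes ::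
  "real \<Rightarrow> real \<Rightarrow> real \<Rightarrow> real \<Rightarrow> (nat \<Rightarrow> real poly) \<Rightarrow> real measure \<Rightarrow> bool" where
  "orthogonalizes q t v w Q \<mu> \<longleftrightarrow>
     (\<forall>m n. integrable \<mu> (\<lambda>x. poly (Q m) x * poly (Q n) x) \<and>
            (\<integral>x. poly (Q m) x * poly (Q n) x \<partial>\<mu>) =
              (if m = n then \<Prod>k=1..n. qt_num k q t * qt_num k v w else 0))"

definition is_quad_measure :: "real \<Rightarrow> real \<Rightarrow> real \<Rightarrow> real \<Rightarrow> real measure \<Rightarrow> bool" where
  "is_quad_measure q t v w \<mu> \<longleftrightarrow>
     real_distribution \<mu> \<and> orthogonalizes q t v w (quad_poly q t v w) \<mu>"

definition quad_measure :: "real \<Rightarrow> real \<Rightarrow> real \<Rightarrow> real \<Rightarrow> real measure" where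
  "quad_measure q t v w = (THE \<mu>. is_quad_measure q t v w \<mu>)"

end

theory Submission
  imports Defs
begin

text \<open>
  The Gaussian operator \<open>G\<close> maps \<open>e\<^sub>n = \<xi>\<^bsup>\<otimes>n\<^esup> \<otimes> \<eta>\<^bsup>\<otimes>n\<^esup>\<close> to \<open>e\<^sub>n\<^sub>+\<^sub>1 + \<omega>\<^sub>n e\<^sub>n\<^sub>-\<^sub>1\<close>, where
  \<open>\<omega>\<^sub>n = [n]\<^bsub>q,t\<^esub> [n]\<^bsub>v,w\<^esub>\<close>: annihilation removes one of \<open>n\<close> equal factors, and the powers of \<open>q, t\<close> and of
  \<open>v, w\<close> add up to the two numbers, while \<open>\<parallel>\<xi>\<parallel> \<parallel>\<eta>\<parallel> = 1\<close>.  Multiplication by \<open>x\<close> acts on the polynomials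
  \<open>Q\<^sub>n\<close> in the same way.  Hence the coordinates of \<open>G\<^sup>k \<Omega>\<close> in the \<open>e\<^sub>n\<close> and those of \<open>x\<^sup>k\<close> in the \<open>Q\<^sub>n\<close>
  agree (\<open>jacobi_iterate\<close>), and their entry at \<open>0\<close>, say \<open>m\<^sub>k\<close>, is both the vacuum moment of \<open>G\<close>
  (\<open>vacuum_state_gauss_power\<close>) and the \<open>k\<close>-th moment of every measure that orthogonalizes \<open>(Q\<^sub>n)\<close>
  (\<open>moments_of_Q\<close>).

  It remains to see that the \<open>m\<^sub>k\<close> are the moments of exactly one probability measure.  The
  restrictions on the parameters give \<open>0 \<le> \<omega>\<^sub>n \<le> B\<close> for a constant \<open>B\<close> (\<open>qt_num_nonneg\<close>, \<open>qt_num_le\<close>).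
  With \<open>L\<close> the linear functional \<open>x\<^sup>k \<mapsto> m\<^sub>k\<close>, the lower bound makes \<open>L\<close> non-negative on squares and the
  upper bound gives \<open>L(x\<^sup>2 p\<^sup>2) \<le> R\<^sup>2 L(p\<^sup>2)\<close> for \<open>R = 2 \<surd>B\<close>.  Together they imply
  \<open>L((R + x)\<^sup>k (R - x)\<^sup>l) \<ge> 0\<close> for all \<open>k, l\<close> (\<open>jacobi_functional_interval_nonneg\<close>), which is the condition
  of the Hausdorff moment problem on \<open>[-R, R]\<close>; its solution (\<open>Hausdorff_moment\<close>) is obtained as a
  weak limit of discrete measures with Bernstein weights.  This gives a measure on \<open>[-R, R]\<close> that
  represents \<open>L\<close> (\<open>Favard_measure\<close>), and so orthogonalizes \<open>(Q\<^sub>n)\<close>.  The argument uses inequalities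
  for \<open>L\<close> only and no strict positivity, so it includes the case that \<open>\<omega>\<^sub>n = 0\<close> for some \<open>n \<ge> 1\<close> and the
  measure has finite support.  Since its even moments are at most \<open>R\<^sup>2\<^sup>k\<close>, no other probability measure has the
  same moments (\<open>bounded_moments_imp_equal\<close>).
\<close>

section \<open>Probability measures determined by their moments\<close>

text \<open>
  Even moments of at most geometric growth make the Taylor expansion of the characteristic function
  converge everywhere to it: the remainder after \<open>2n\<close> terms is at most
  \<open>2 (\<bar>s\<bar> R)\<^sup>2\<^sup>n / (2n)!\<close>.  The moments therefore determine the characteristic function, and this
  determines the measure.  The growth of the moments is assumed, and not bounded support, because for a
  measure that is only known to orthogonalize polynomials the moments are all the information there is.
\<close>

lemma bounded_moments_imp_equal:
  fixes M N :: "real measure"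
  assumes M: "real_distribution M" and N: "real_distribution N"
    and intM: "\<And>k. integrable M (\<lambda>x. x ^ k)" and intN: "\<And>k. integrable N (\<lambda>x. x ^ k)"
    and eq: "\<And>k. (\<integral>x. x ^ k \<partial>M) = (\<integral>x. x ^ k \<partial>N)"
    and bound: "\<And>k. (\<integral>x. x ^ (2 * k) \<partial>M) \<le> R ^ (2 * k)"
  shows "M = N"
proof (rule Levy_uniqueness[OF M N], rule ext)
  interpret M: real_distribution M by fact
  interpret N: real_distribution N by fact
  fix s :: real
  define a where "a n = 4 * (inverse (fact (2 * n)) *\<^sub>R (\<bar>s\<bar> * R) ^ (2 * n))" for n
  have "norm (char M s - char N s) \<le> a n" for n
  proof -
    let ?T = "\<Sum>k\<le>2 * n. ((\<i> * s) ^ k / fact k) * complex_of_real (\<integral>x. x ^ k \<partial>M)"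
    have pow: "\<bar>x\<bar> ^ (2 * n) = x ^ (2 * n)" for x :: real
      by (simp add: power_even_abs)
    have le: "2 * \<bar>s\<bar> ^ (2 * n) / fact (2 * n) * (\<integral>x. x ^ (2 * n) \<partial>M) \<le> a n / 2"
    proof -
      have "2 * \<bar>s\<bar> ^ (2 * n) / fact (2 * n) * (\<integral>x. x ^ (2 * n) \<partial>M)
          \<le> 2 * \<bar>s\<bar> ^ (2 * n) / fact (2 * n) * R ^ (2 * n)"
        by (intro mult_left_mono bound) simp
      also have "\<dots> = a n / 2"
        by (simp add: a_def power_mult_distrib field_simps)
      finally show ?thesis .
    qed
    have "norm (char M s - ?T) \<le> a n / 2"
      using M.char_approx1[of "2 * n" s, OF intM] le unfolding pow by linarith
    moreover have "norm (char N s - ?T) \<le> a n / 2"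
      using N.char_approx1[of "2 * n" s, OF intN] le unfolding pow eq by linarith
    ultimately show ?thesis
      using norm_triangle_ineq4[of "char M s - ?T" "char N s - ?T"] by simp
  qed
  moreover have "a \<longlonglongrightarrow> 0"
  proof -
    have "(\<lambda>n. inverse (fact n) *\<^sub>R (\<bar>s\<bar> * R) ^ n) \<longlonglongrightarrow> 0"
      by (rule summable_LIMSEQ_zero[OF summable_exp_generic])
    then have "((\<lambda>n. inverse (fact n) *\<^sub>R (\<bar>s\<bar> * R) ^ n) \<circ> (\<lambda>n. 2 * n)) \<longlonglongrightarrow> 0"
      by (rule LIMSEQ_subseq_LIMSEQ) (simp add: strict_mono_def)
    from tendsto_mult_left[OF this, of 4] show ?thesis
      unfolding a_def by (simp add: comp_def)
  qed
  ultimately have "norm (char M s - char N s) \<le> 0"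
    by (intro LIMSEQ_le_const[of a]) auto
  then show "char M s = char N s" by simp
qed

lemma integrable_power_of_AE_bounded:
  fixes M :: "real measure"
  assumes "real_distribution M" "AE x in M. \<bar>x\<bar> \<le> R"
  shows "integrable M (\<lambda>x. x ^ k)"
proof -
  interpret real_distribution M by fact
  have "AE x in M. norm (x ^ k) \<le> R ^ k"
    using assms(2) by eventually_elim (simp add: power_abs power_mono)
  then show ?thesis by (intro integrable_const_bound) auto
qed

lemma integral_even_power_le:
  fixes M :: "real measure"
  assumes "real_distribution M" "AE x in M. \<bar>x\<bar> \<le> R"
  shows "(\<integral>x. x ^ (2 * k) \<partial>M) \<le> R ^ (2 * k)"
proof -
  interpret real_distribution M by fact
  have "(\<integral>x. x ^ (2 * k) \<partial>M) \<le> (\<integral>x. R ^ (2 * k) \<partial>M)"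
  proof (rule integral_mono_AE)
    show "AE x in M. x ^ (2 * k) \<le> R ^ (2 * k)"
      using assms(2)
    proof eventually_elim
      case (elim x)
      then have "\<bar>x\<bar> ^ (2 * k) \<le> R ^ (2 * k)" by (intro power_mono) auto
      then show ?case by (simp add: power_even_abs)
    qed
  qed (auto intro: integrable_power_of_AE_bounded[OF assms])
  then show ?thesis using prob_space by simp
qed

section \<open>The Hausdorff moment problem\<close>

text \<open>
  Here \<open>d k l\<close> plays the part of \<open>\<integral>x\<^sup>k (1 - x)\<^sup>l\<close>; the recurrence is \<open>1 = x + (1 - x)\<close>, and the
  expansion is the binomial theorem for \<open>(x + (1 - x))\<^sup>m\<close>.
\<close>

lemma completely_monotone_expand:
  fixes d :: "nat \<Rightarrow> nat \<Rightarrow> real"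
  assumes rec: "\<And>k l. d k l = d (Suc k) l + d k (Suc l)"
  shows "d j l = (\<Sum>i\<le>m. of_nat (m choose i) * d (j + i) (l + (m - i)))"
proof (induction m arbitrary: j l)
  case 0
  show ?case by simp
next
  case (Suc m)
  have eq: "(\<Sum>i\<le>m. real (m choose i) * d (Suc j + i) (l + (m - i)))
      = (\<Sum>i\<le>Suc m. (if i = 0 then 0 else real (m choose (i - 1))) * d (j + i) (l + (Suc m - i)))"
    by (subst sum.atMost_Suc_shift) simp
  have eq2: "(\<Sum>i\<le>m. real (m choose i) * d (j + i) (Suc l + (m - i)))
      = (\<Sum>i\<le>Suc m. real (m choose i) * d (j + i) (l + (Suc m - i)))"
    by (simp add: Suc_diff_le)
  have pascal: "real (Suc m choose i) = (if i = 0 then 0 else real (m choose (i - 1))) + real (m choose i)" for i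
    by (cases i) auto
  have "d j l = d (Suc j) l + d j (Suc l)" by (rule rec)
  also have "d (Suc j) l = (\<Sum>i\<le>m. real (m choose i) * d (Suc j + i) (l + (m - i)))" by (rule Suc.IH)
  also have "d j (Suc l) = (\<Sum>i\<le>m. real (m choose i) * d (j + i) (Suc l + (m - i)))" by (rule Suc.IH)
  finally show ?case
    unfolding eq eq2 by (simp only: sum.distrib[symmetric] distrib_right[symmetric] pascal[symmetric])
qed

text \<open>
  This is \<open>k(k-1)\<cdots>(k-j+1) / (n(n-1)\<cdots>(n-j+1))\<close>, the quantity that reproduces \<open>x\<^sup>j\<close> exactly when it is
  averaged against the Bernstein polynomials of degree \<open>n\<close>.
\<close>

definition falling_ratio :: "nat \<Rightarrow> nat \<Rightarrow> nat \<Rightarrow> real" where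
  "falling_ratio j n k = (\<Prod>i<j. (real k - real i) / (real n - real i))"

text \<open>
  The factor with \<open>i = k\<close> makes the product vanish for \<open>k < j\<close>.
\<close>

lemma falling_ratio_choose:
  assumes "j \<le> n" "k \<le> n"
  shows "real (n choose k) * falling_ratio j n k = (if j \<le> k then real ((n - j) choose (k - j)) else 0)"
  using assms(1)
proof (induction j)
  case 0
  then show ?case by (simp add: falling_ratio_def)
next
  case (Suc j)
  have step: "falling_ratio (Suc j) n k = falling_ratio j n k * ((real k - real j) / (real n - real j))"
    by (simp add: falling_ratio_def)
  have IH: "real (n choose k) * falling_ratio j n k = (if j \<le> k then real ((n - j) choose (k - j)) else 0)"
    using Suc by simp
  consider "k < j" | "k = j" | "Suc j \<le> k" by linarith
  then show ?case
  proof cases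
    case 3
    have "(k - j) * ((n - j) choose (k - j)) = (n - j) * ((n - Suc j) choose (k - Suc j))"
      using binomial_absorption[of "k - Suc j" "n - j"] 3 Suc.prems
      by (simp add: Suc_diff_Suc)
    then have "real (k - j) * real ((n - j) choose (k - j)) = real (n - j) * real ((n - Suc j) choose (k - Suc j))"
      by (metis of_nat_mult)
    then have "(real k - real j) * real ((n - j) choose (k - j)) = (real n - real j) * real ((n - Suc j) choose (k - Suc j))"
      using 3 Suc.prems by (simp add: of_nat_diff)
    moreover have "real n - real j > 0" using Suc.prems by simp
    ultimately show ?thesis
      using IH 3 by (simp add: step field_simps)
  next
    case 1
    then show ?thesis using IH by (simp add: step)
  next
    case 2
    then show ?thesis unfolding step by simp
  qed
qed

text \<open>
  Each of the \<open>j\<close> factors differs from \<open>k / n\<close> by \<open>O(1/n)\<close>, uniformly in \<open>k\<close>.  The condition \<open>2 j \<le> n\<close>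
  keeps all factors in \<open>[-1, 1]\<close>, also those that are negative because \<open>k < i\<close>, and keeps the
  denominators above \<open>n / 2\<close>.
\<close>

lemma falling_ratio_bound:
  assumes "k \<le> n" "2 * j \<le> n"
  shows "\<bar>falling_ratio j n k - (real k / real n) ^ j\<bar> \<le> real j * (2 * real j / real n)"
proof (cases "n = 0")
  case True
  then show ?thesis using assms by (simp add: falling_ratio_def)
next
  case False
  then have n: "real n > 0" by simp
  have "norm ((\<Prod>i<j. (real k - real i) / (real n - real i)) - (\<Prod>i<j. real k / real n))
      \<le> (\<Sum>i<j. norm ((real k - real i) / (real n - real i) - real k / real n))"
  proof (rule norm_prod_diff)
    fix i assume "i \<in> {..<j}"
    then have i: "2 * real i < real n" using assms(2) by simp
    have "\<bar>real k - real i\<bar> \<le> real n - real i" using i assms(1) by (simp add: abs_le_iff)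
    then show "norm ((real k - real i) / (real n - real i)) \<le> 1"
      using i by (simp add: abs_le_iff field_simps)
  next
    show "norm (real k / real n) \<le> 1" using assms(1) n by simp
  qed
  also have "\<dots> \<le> (\<Sum>i<j. 2 * real j / real n)"
  proof (rule sum_mono)
    fix i assume "i \<in> {..<j}"
    then have i: "2 * real i < real n" "real i \<le> real j" using assms(2) by auto
    have pos: "real n - real i > 0" using i by linarith
    have "(real k - real i) / (real n - real i) - real k / real n
        = - (real i * (real n - real k) / ((real n - real i) * real n))"
      using pos n by (simp add: field_simps)
    then have "norm ((real k - real i) / (real n - real i) - real k / real n)
        = real i * (real n - real k) / ((real n - real i) * real n)"
      using pos n assms(1) by (simp add: abs_mult)
    also have "\<dots> \<le> real i * real n / ((real n / 2) * real n)"
      using pos n i assms(1) by (intro frac_le mult_mono mult_left_mono mult_right_mono) auto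
    also have "\<dots> = 2 * real i / real n" using n by (simp add: field_simps)
    also have "\<dots> \<le> 2 * real j / real n" using i n by (simp add: divide_right_mono)
    finally show "norm ((real k - real i) / (real n - real i) - real k / real n) \<le> 2 * real j / real n" .
  qed
  finally show ?thesis by (simp add: falling_ratio_def)
qed

text \<open>
  The numbers \<open>p n k\<close> are the would-be integrals of the Bernstein polynomials.  They are non-negative
  with sum 1, so they are the masses of a probability measure \<open>\<nu> n\<close> on the points \<open>k / n\<close>.  The
  \<open>j\<close>-th moment of \<open>\<nu> n\<close> differs from \<open>d j 0\<close> only in that \<open>(k / n)\<^sup>j\<close> replaces \<open>falling_ratio j n k\<close>,
  hence tends to \<open>d j 0\<close>.  All \<open>\<nu> n\<close> live on \<open>[0, 1]\<close>, so a subsequence converges weakly, and its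
  limit has the required moments.
\<close>

theorem Hausdorff_moment:
  fixes d :: "nat \<Rightarrow> nat \<Rightarrow> real"
  assumes rec: "\<And>k l. d k l = d (Suc k) l + d k (Suc l)"
    and nonneg: "\<And>k l. 0 \<le> d k l" and one: "d 0 0 = 1"
  obtains M where "real_distribution M" "AE x in M. x \<in> {0..1}" "\<And>k. (\<integral>x. x ^ k \<partial>M) = d k 0"
proof -
  define p where "p n k = real (n choose k) * d k (n - k)" for n k
  have p_nonneg: "0 \<le> p n k" for n k by (simp add: p_def nonneg)
  have p_sum: "(\<Sum>k\<le>n. p n k) = 1" for n
    using completely_monotone_expand[of d 0 0 n, OF rec] by (simp add: p_def one)
  define \<nu> where "\<nu> n = distr (point_measure {..n} (\<lambda>k. ennreal (p n k))) borel (\<lambda>k. real k / real n)" for n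
  have integral_\<nu>: "(\<integral>x. g x \<partial>\<nu> n) = (\<Sum>k\<le>n. p n k * g (real k / real n))"
    if "g \<in> borel_measurable borel" for g :: "real \<Rightarrow> real" and n
    unfolding \<nu>_def using that
    by (subst integral_distr) (simp_all add: lebesgue_integral_point_measure_finite p_nonneg)
  have rd: "real_distribution (\<nu> n)" for n
  proof -
    have "prob_space (point_measure {..n} (\<lambda>k. ennreal (p n k)))"
      by (rule prob_space_point_measure) (auto simp: p_nonneg p_sum)
    then have "prob_space (\<nu> n)"
      unfolding \<nu>_def by (rule prob_space.prob_space_distr) simp
    then show ?thesis
      by (simp add: real_distribution_def real_distribution_axioms_def \<nu>_def)
  qed
  have meas: "measure (\<nu> n) {-1<..1} = 1" for n
  proof -
    interpret real_distribution "\<nu> n" by (rule rd)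
    have "measure (\<nu> n) {-1<..1} = (\<integral>x. indicator {-1<..1} x \<partial>\<nu> n)" by simp
    also have "\<dots> = (\<Sum>k\<le>n. p n k * indicator {-1<..1} (real k / real n))"
      by (rule integral_\<nu>) simp
    also have "\<dots> = (\<Sum>k\<le>n. p n k)"
    proof (rule sum.cong)
      fix k assume k: "k \<in> {..n}"
      have "0 \<le> real k / real n" "real k / real n \<le> 1" using k by (auto simp: divide_le_eq)
      then have "real k / real n \<in> {-1<..1}" by (auto intro: less_le_trans[of _ 0])
      then show "p n k * indicator {-1<..1} (real k / real n) = p n k"
        by (simp only: indicator_simps mult_1_right)
    qed simp
    finally show ?thesis by (simp add: p_sum)
  qed
  have "tight \<nu>"
    unfolding tight_def
  proof (intro conjI allI impI)
    fix e :: real assume "e > 0"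
    then show "\<exists>a b. a < b \<and> (\<forall>n. 1 - e < measure (\<nu> n) {a<..b})"
      by (intro exI[of _ "-1"] exI[of _ 1]) (simp add: meas)
  qed (rule rd)
  from tight_imp_convergent_subsubsequence[OF this, of id]
  obtain r M where r: "strict_mono (r :: nat \<Rightarrow> nat)" and M: "real_distribution M"
    and conv: "weak_conv_m (\<nu> \<circ> r) M" by (auto simp: strict_mono_id)
  interpret M: real_distribution M by fact
  \<comment> \<open>Powers are unbounded on the line; precomposing with this retraction onto the unit interval makes them bounded without changing their integrals.\<close>
  define c where "c x = max 0 (min 1 x)" for x :: real
  have c_range: "0 \<le> c x" "c x \<le> 1" for x by (auto simp: c_def)
  have c_cont: "continuous_on UNIV c" unfolding c_def by (intro continuous_intros)
  have c_id: "c (real k / real n) = real k / real n" if "k \<le> n" for k n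
  proof -
    have "0 \<le> real k / real n" "real k / real n \<le> 1" using that by (auto simp: divide_le_eq)
    then show ?thesis by (simp add: c_def)
  qed
  have lim: "(\<lambda>n. \<Sum>k\<le>r n. p (r n) k * g (real k / real (r n))) \<longlonglongrightarrow> (\<integral>x. g x \<partial>M)"
    if g: "continuous_on UNIV g" "\<And>x. norm (g x) \<le> 1" for g :: "real \<Rightarrow> real"
  proof -
    have "(\<lambda>n. \<integral>x. g x \<partial>(\<nu> \<circ> r) n) \<longlonglongrightarrow> (\<integral>x. g x \<partial>M)"
      by (rule weak_conv_imp_integral_bdd_continuous_conv[of "\<nu> \<circ> r"])
        (use M rd conv g in \<open>auto simp: continuous_on_eq_continuous_at\<close>)
    moreover have "g \<in> borel_measurable borel" using g(1) by (rule borel_measurable_continuous_onI)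
    ultimately show ?thesis by (simp add: integral_\<nu>)
  qed
  have supp: "AE x in M. x \<in> {0..1}"
  proof -
    \<comment> \<open>A bounded continuous function that vanishes exactly on the unit interval.\<close>
    let ?h = "\<lambda>x. min 1 \<bar>x - c x\<bar>"
    have "(\<lambda>n. \<Sum>k\<le>r n. p (r n) k * ?h (real k / real (r n))) \<longlonglongrightarrow> (\<integral>x. ?h x \<partial>M)"
      by (rule lim) (auto intro!: continuous_intros c_cont)
    moreover have "(\<Sum>k\<le>r n. p (r n) k * ?h (real k / real (r n))) = 0" for n
      by (rule sum.neutral) (simp add: c_id)
    ultimately have 0: "(\<integral>x. ?h x \<partial>M) = 0"
      using LIMSEQ_unique[OF tendsto_const] by fastforce
    have h_meas: "?h \<in> borel_measurable M"
      using borel_measurable_continuous_onI[OF c_cont] by measurable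
    have "integrable M ?h"
      by (rule M.integrable_const_bound[of _ 1]) (auto intro: h_meas)
    then have "AE x in M. ?h x = 0"
      using integral_nonneg_eq_0_iff_AE[of M ?h] 0 by simp
    then show ?thesis
    proof eventually_elim
      case (elim x)
      then have "x = c x" by (auto simp: min_def split: if_splits)
      then show ?case using c_range[of x] by simp
    qed
  qed
  have "(\<integral>x. x ^ j \<partial>M) = d j 0" for j
  proof (rule LIMSEQ_unique)
    let ?S = "\<lambda>n. \<Sum>k\<le>n. p n k * (real k / real n) ^ j"
    have "(\<lambda>n. \<Sum>k\<le>r n. p (r n) k * c (real k / real (r n)) ^ j) \<longlonglongrightarrow> (\<integral>x. c x ^ j \<partial>M)"
      by (rule lim) (auto intro!: continuous_intros c_cont simp: c_range power_le_one)
    moreover have "(\<integral>x. c x ^ j \<partial>M) = (\<integral>x. x ^ j \<partial>M)"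
    proof (rule integral_cong_AE)
      show "AE x in M. c x ^ j = x ^ j" using supp by eventually_elim (simp add: c_def)
    qed (use borel_measurable_continuous_onI[OF c_cont] in measurable)
    ultimately show "(\<lambda>n. ?S (r n)) \<longlonglongrightarrow> (\<integral>x. x ^ j \<partial>M)"
      by (simp add: c_id)
    have exact: "d j 0 = (\<Sum>k\<le>n. p n k * falling_ratio j n k)" if "j \<le> n" for n
    proof -
      have "d j 0 = (\<Sum>i\<le>n - j. real ((n - j) choose i) * d (j + i) (n - j - i))"
        using completely_monotone_expand[of d j 0 "n - j", OF rec] by simp
      also have "\<dots> = (\<Sum>k\<in>{j..n}. real ((n - j) choose (k - j)) * d k (n - k))"
        using that by (intro sum.reindex_bij_witness[of _ "\<lambda>k. k - j" "\<lambda>i. j + i"]) auto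
      also have "\<dots> = (\<Sum>k\<le>n. (if j \<le> k then real ((n - j) choose (k - j)) else 0) * d k (n - k))"
        by (rule sum.mono_neutral_cong_left) auto
      also have "\<dots> = (\<Sum>k\<le>n. p n k * falling_ratio j n k)"
      proof (rule sum.cong)
        fix k assume "k \<in> {..n}"
        then show "(if j \<le> k then real ((n - j) choose (k - j)) else 0) * d k (n - k) = p n k * falling_ratio j n k"
          using falling_ratio_choose[of j n k] that by (simp add: p_def ac_simps)
      qed simp
      finally show ?thesis .
    qed
    have "?S \<longlonglongrightarrow> d j 0"
    proof (rule LIM_zero_cancel, rule Lim_null_comparison)
      show "\<forall>\<^sub>F n in sequentially. norm (?S n - d j 0) \<le> real j * (2 * real j / real n)"
        using eventually_ge_at_top[of "2 * j"]
      proof eventually_elim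
        case (elim n)
        have "?S n - d j 0 = (\<Sum>k\<le>n. p n k * ((real k / real n) ^ j - falling_ratio j n k))"
          using exact[of n] elim by (simp add: right_diff_distrib sum_subtractf)
        also have "norm \<dots> \<le> (\<Sum>k\<le>n. p n k * (real j * (2 * real j / real n)))"
        proof (rule sum_norm_le)
          fix k assume "k \<in> {..n}"
          then have "\<bar>(real k / real n) ^ j - falling_ratio j n k\<bar> \<le> real j * (2 * real j / real n)"
            using falling_ratio_bound[of k n j] elim by (simp add: abs_minus_commute)
          from mult_left_mono[OF this p_nonneg[of n k]]
          show "norm (p n k * ((real k / real n) ^ j - falling_ratio j n k))
              \<le> p n k * (real j * (2 * real j / real n))"
            by (simp only: abs_mult real_norm_def abs_of_nonneg[OF p_nonneg])
        qed
        also have "\<dots> = real j * (2 * real j / real n)"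
          by (simp only: sum_distrib_right[symmetric] p_sum mult_1_left)
        finally show ?case .
      qed
      have "(\<lambda>n. real j * (2 * real j) * inverse (real n)) \<longlonglongrightarrow> real j * (2 * real j) * 0"
        by (intro tendsto_mult_left lim_inverse_n)
      then show "(\<lambda>n. real j * (2 * real j / real n)) \<longlonglongrightarrow> 0"
        by (simp add: divide_inverse mult.assoc)
    qed
    then show "(\<lambda>n. ?S (r n)) \<longlonglongrightarrow> d j 0"
      using LIMSEQ_subseq_LIMSEQ[OF _ r] by (auto simp: comp_def)
  qed
  then show ?thesis using that M supp by blast
qed


section \<open>Three-term recurrences and Favard's theorem\<close>

definition unit_seq :: "nat \<Rightarrow> nat \<Rightarrow> real" where
  "unit_seq m n = (if n = m then 1 else 0)"

text \<open>
  In the coordinates \<open>f\<close> of a polynomial \<open>\<Sum>n. f n Q\<^sub>n\<close> this is multiplication by \<open>x\<close> when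
  \<open>x Q\<^sub>n = Q\<^sub>n\<^sub>+\<^sub>1 + \<omega>\<^sub>n Q\<^sub>n\<^sub>-\<^sub>1\<close>.  The basis is left unnormalised: it is not symmetrised by square roots of
  the \<open>\<omega>\<^sub>n\<close>, because these may vanish (\<open>[2]\<^bsub>q,t\<^esub> = 0\<close> for \<open>q = -t\<close>).  Symmetry holds for the weighted
  inner product with weights \<open>jacobi_weight \<omega>\<close> instead.
\<close>

definition jacobi :: "(nat \<Rightarrow> real) \<Rightarrow> (nat \<Rightarrow> real) \<Rightarrow> nat \<Rightarrow> real" where
  "jacobi \<omega> f n = (if n = 0 then 0 else f (n - 1)) + \<omega> (Suc n) * f (Suc n)"

text \<open>
  Horner evaluation of \<open>p(J) e\<^sub>0\<close>, with \<open>J\<close> the operator \<open>jacobi \<omega>\<close>; these are the coordinates of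
  \<open>p\<close> with respect to the polynomials \<open>Q\<^sub>n\<close>.
\<close>

definition jacobi_vec :: "(nat \<Rightarrow> real) \<Rightarrow> real poly \<Rightarrow> nat \<Rightarrow> real" where
  "jacobi_vec \<omega> p =
     fold_coeffs (\<lambda>a f n. a * unit_seq 0 n + jacobi \<omega> f n) p (\<lambda>n. 0)"

text \<open>
  The vacuum expectation of \<open>p(J)\<close>, and the integral of \<open>p\<close> against the orthogonalizing measure once
  this measure has been found.
\<close>

definition jacobi_functional :: "(nat \<Rightarrow> real) \<Rightarrow> real poly \<Rightarrow> real" where
  "jacobi_functional \<omega> p = jacobi_vec \<omega> p 0"

text \<open>
  The squared norm of \<open>Q\<^sub>n\<close>.
\<close>

definition jacobi_weight :: "(nat \<Rightarrow> real) \<Rightarrow> nat \<Rightarrow> real" where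
  "jacobi_weight \<omega> n = (\<Prod>k=1..n. \<omega> k)"

lemma jacobi_weight_0 [simp]: "jacobi_weight \<omega> 0 = 1"
  by (simp add: jacobi_weight_def)

lemma jacobi_weight_Suc [simp]: "jacobi_weight \<omega> (Suc n) = jacobi_weight \<omega> n * \<omega> (Suc n)"
  by (simp add: jacobi_weight_def)

lemma jacobi_add: "jacobi \<omega> (\<lambda>n. f n + g n) = (\<lambda>n. jacobi \<omega> f n + jacobi \<omega> g n)"
  by (auto simp: fun_eq_iff jacobi_def algebra_simps)

lemma jacobi_scale: "jacobi \<omega> (\<lambda>n. c * f n) = (\<lambda>n. c * jacobi \<omega> f n)"
  by (auto simp: fun_eq_iff jacobi_def algebra_simps)

lemma jacobi_zero [simp]: "jacobi \<omega> (\<lambda>n. 0) = (\<lambda>n. 0)"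
  by (auto simp: fun_eq_iff jacobi_def)

lemma jacobi_vec_0 [simp]: "jacobi_vec \<omega> 0 = (\<lambda>n. 0)"
  by (simp add: jacobi_vec_def)

lemma jacobi_vec_pCons:
  "jacobi_vec \<omega> (pCons a p) = (\<lambda>n. a * unit_seq 0 n + jacobi \<omega> (jacobi_vec \<omega> p) n)"
proof (cases "p = 0 \<and> a = 0")
  case False
  then show ?thesis by (auto simp: jacobi_vec_def)
qed simp

lemma jacobi_vec_add: "jacobi_vec \<omega> (p + q) = (\<lambda>n. jacobi_vec \<omega> p n + jacobi_vec \<omega> q n)"
  by (induction p q rule: poly_induct2) (simp_all add: jacobi_vec_pCons jacobi_add algebra_simps)

lemma jacobi_vec_smult: "jacobi_vec \<omega> (smult c p) = (\<lambda>n. c * jacobi_vec \<omega> p n)"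
  by (induction p) (simp_all add: jacobi_vec_pCons jacobi_scale algebra_simps)

lemma jacobi_vec_diff: "jacobi_vec \<omega> (p - q) = (\<lambda>n. jacobi_vec \<omega> p n - jacobi_vec \<omega> q n)"
  using jacobi_vec_add[of \<omega> p "smult (-1) q"] jacobi_vec_smult[of \<omega> "-1" q] by simp

lemma jacobi_vec_x_mult: "jacobi_vec \<omega> ([:0, 1:] * p) = jacobi \<omega> (jacobi_vec \<omega> p)"
  by (simp add: jacobi_vec_pCons)

lemma jacobi_vec_1: "jacobi_vec \<omega> 1 = unit_seq 0"
  by (simp add: one_pCons jacobi_vec_pCons)

lemma jacobi_vec_x_power: "jacobi_vec \<omega> ([:0, 1:] ^ k) = (jacobi \<omega> ^^ k) (unit_seq 0)"
proof (induction k)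
  case (Suc k)
  then show ?case by (simp only: power_Suc jacobi_vec_x_mult) simp
qed (simp add: jacobi_vec_1)

lemma jacobi_vec_eq_0: "degree p < n \<Longrightarrow> jacobi_vec \<omega> p n = 0"
proof (induction p arbitrary: n)
  case (pCons a p)
  show ?case
  proof (cases "p = 0")
    case True
    then show ?thesis using pCons.prems by (simp add: jacobi_vec_pCons unit_seq_def)
  next
    case False
    then obtain m where n: "n = Suc m" "degree p < m"
      using pCons.prems by (cases n) auto
    then show ?thesis
      using pCons.IH[of m] pCons.IH[of "Suc (Suc m)"]
      by (simp add: jacobi_vec_pCons unit_seq_def jacobi_def)
  qed
qed simp

lemma jacobi_unit_seq:
  "jacobi \<omega> (unit_seq n) = (\<lambda>m. unit_seq (Suc n) m + (if n = 0 then 0 else \<omega> n * unit_seq (n - 1) m))"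
  by (cases n) (auto simp: fun_eq_iff jacobi_def unit_seq_def)

text \<open>
  A linear map that raises and lowers a sequence of vectors \<open>E\<^sub>n\<close> as multiplication by \<open>x\<close> does with
  \<open>Q\<^sub>n\<close> has the powers of \<open>J\<close> as coordinates of its iterates on \<open>E\<^sub>0\<close>.  It is applied twice, to
  multiplication by \<open>x\<close> on polynomials and to the Gaussian operator on Fock space, and this is why
  both lead to the same moments.
\<close>

lemma jacobi_iterate:
  fixes T :: "'a :: ab_group_add \<Rightarrow> 'a" and s :: "real \<Rightarrow> 'a \<Rightarrow> 'a"
  assumes T_add: "\<And>x y. T (x + y) = T x + T y" and T_s: "\<And>c x. T (s c x) = s c (T x)"
    and s_left: "\<And>a b x. s (a + b) x = s a x + s b x" and s_right: "\<And>c x y. s c (x + y) = s c x + s c y"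
    and s_s: "\<And>a b x. s a (s b x) = s (a * b) x" and s_1: "\<And>x. s 1 x = x"
    and T_E: "\<And>n. T (E n) = E (Suc n) + (if n = 0 then 0 else s (\<omega> n) (E (n - 1)))"
  shows "(T ^^ k) (E 0) = (\<Sum>n\<le>k. s ((jacobi \<omega> ^^ k) (unit_seq 0) n) (E n))"
proof -
  have s_0: "s 0 x = 0" for x using s_left[of 0 0 x] by simp
  have sum: "(\<Sum>n\<le>M. s (jacobi \<omega> f n) (E n)) =
      T (\<Sum>n\<le>M. s (f n) (E n)) - s (f M) (E (Suc M)) + s (\<omega> (Suc M) * f (Suc M)) (E M)" for f M
  proof (induction M)
    case 0
    show ?case by (simp add: jacobi_def T_s T_E)
  next
    case (Suc M)
    have x: "T (s (f (Suc M)) (E (Suc M))) = s (f (Suc M)) (E (Suc (Suc M))) + s (\<omega> (Suc M) * f (Suc M)) (E M)"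
      by (simp add: T_s T_E s_right s_s mult.commute)
    have j: "s (jacobi \<omega> f (Suc M)) (E (Suc M)) =
        s (f M) (E (Suc M)) + s (\<omega> (Suc (Suc M)) * f (Suc (Suc M))) (E (Suc M))"
      by (simp add: jacobi_def s_left)
    show ?case
      unfolding sum.atMost_Suc Suc.IH T_add x j by simp
  qed
  show ?thesis
  proof (induction k)
    case 0
    show ?case by (simp add: unit_seq_def s_1)
  next
    case (Suc k)
    let ?f = "(jacobi \<omega> ^^ k) (unit_seq 0)"
    have "degree ([:0, 1:] ^ k :: real poly) = k" by (simp add: degree_power_eq)
    then have vanish: "?f (Suc k) = 0" "?f (Suc (Suc k)) = 0"
      unfolding jacobi_vec_x_power[symmetric] by (simp_all add: jacobi_vec_eq_0)
    have "(\<Sum>n\<le>Suc k. s (jacobi \<omega> ?f n) (E n)) = T (\<Sum>n\<le>Suc k. s (?f n) (E n))"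
      unfolding sum using vanish by (simp add: s_0)
    also have "\<dots> = T (\<Sum>n\<le>k. s (?f n) (E n))"
      using vanish by (simp add: s_0)
    finally show ?case using Suc.IH by simp
  qed
qed

text \<open>
  With \<open>W\<^sub>n\<close> the weights, \<open>W\<^sub>n \<omega>\<^sub>n\<^sub>+\<^sub>1 = W\<^sub>n\<^sub>+\<^sub>1\<close>, so the truncated form \<open>\<langle>J f, g\<rangle>\<close> is symmetric in \<open>f\<close> and \<open>g\<close>
  up to one boundary term.
\<close>

lemma jacobi_form_telescope:
  "(\<Sum>n\<le>M. jacobi_weight \<omega> n * jacobi \<omega> f n * g n) =
     (\<Sum>n<M. jacobi_weight \<omega> (Suc n) * (f n * g (Suc n) + f (Suc n) * g n)) +
     jacobi_weight \<omega> (Suc M) * f (Suc M) * g M"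
  by (induction M) (simp_all add: jacobi_def algebra_simps)

lemma jacobi_symmetric:
  assumes "f M = 0" "f (Suc M) = 0"
  shows "(\<Sum>n\<le>M. jacobi_weight \<omega> n * jacobi \<omega> f n * g n) =
         (\<Sum>n\<le>M. jacobi_weight \<omega> n * f n * jacobi \<omega> g n)"
proof -
  have "(\<Sum>n\<le>M. jacobi_weight \<omega> n * f n * jacobi \<omega> g n) = (\<Sum>n\<le>M. jacobi_weight \<omega> n * jacobi \<omega> g n * f n)"
    by (simp only: ac_simps)
  then show ?thesis
    unfolding jacobi_form_telescope using assms by (simp add: algebra_simps)
qed

text \<open>
  By symmetry of \<open>J\<close>, \<open>\<langle>e\<^sub>0, (p q)(J) e\<^sub>0\<rangle> = \<langle>p(J) e\<^sub>0, q(J) e\<^sub>0\<rangle>\<close>.  Everything that follows about positivity and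
  orthogonality is read off from this formula.
\<close>

lemma jacobi_functional_mult:
  assumes "degree p \<le> M"
  shows "jacobi_functional \<omega> (p * q) =
           (\<Sum>n\<le>M. jacobi_weight \<omega> n * jacobi_vec \<omega> p n * jacobi_vec \<omega> q n)"
  using assms
proof (induction p arbitrary: q)
  case 0
  show ?case by (simp add: jacobi_functional_def)
next
  case (pCons a p)
  let ?v = "jacobi_vec \<omega>"
  have unit: "(\<Sum>n\<le>M. jacobi_weight \<omega> n * (a * unit_seq 0 n) * g n) = a * g 0" for g
  proof -
    have "(\<Sum>n\<le>M. jacobi_weight \<omega> n * (a * unit_seq 0 n) * g n) = (\<Sum>n\<le>M. if n = 0 then a * g 0 else 0)"
      by (intro sum.cong) (auto simp: unit_seq_def)
    then show ?thesis by simp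
  qed
  have low: "?v p M = 0 \<and> ?v p (Suc M) = 0 \<or> p = 0"
    using pCons.prems jacobi_vec_eq_0[of p M \<omega>] jacobi_vec_eq_0[of p "Suc M" \<omega>] by (cases "p = 0") auto
  have "degree p \<le> M" using pCons.prems by (cases "p = 0") auto
  have "pCons a p * q = smult a q + p * ([:0, 1:] * q)"
    by (simp add: mult_pCons_left)
  then have "jacobi_functional \<omega> (pCons a p * q) = a * ?v q 0 + jacobi_functional \<omega> (p * ([:0, 1:] * q))"
    by (simp only: jacobi_functional_def jacobi_vec_add jacobi_vec_smult)
  also have "jacobi_functional \<omega> (p * ([:0, 1:] * q)) =
      (\<Sum>n\<le>M. jacobi_weight \<omega> n * ?v p n * jacobi \<omega> (?v q) n)"
    unfolding pCons.IH[OF \<open>degree p \<le> M\<close>] jacobi_vec_x_mult ..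
  also have "\<dots> = (\<Sum>n\<le>M. jacobi_weight \<omega> n * jacobi \<omega> (?v p) n * ?v q n)"
    using low by (auto intro: jacobi_symmetric[symmetric])
  also have "a * ?v q 0 + \<dots> = (\<Sum>n\<le>M. jacobi_weight \<omega> n * ?v (pCons a p) n * ?v q n)"
    unfolding unit[of "?v q", symmetric] sum.distrib[symmetric] jacobi_vec_pCons
    by (intro sum.cong refl) (simp add: algebra_simps)
  finally show ?case .
qed

text \<open>
  This says \<open>\<parallel>J f\<parallel>\<^sup>2 \<le> 4 B \<parallel>f\<parallel>\<^sup>2\<close>: in \<open>(a + b)\<^sup>2 \<le> 2 a\<^sup>2 + 2 b\<^sup>2\<close>, applied to the raising part \<open>a\<close> and the
  lowering part \<open>b\<close> of \<open>J f\<close>, each part costs one factor \<open>\<omega>\<^sub>n \<le> B\<close>.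
\<close>

lemma jacobi_functional_x_square_le:
  assumes "\<And>n. 0 \<le> \<omega> n" "\<And>n. \<omega> n \<le> B"
  shows "jacobi_functional \<omega> (([:0, 1:] * p)\<^sup>2) \<le> 4 * B * jacobi_functional \<omega> (p\<^sup>2)"
proof -
  let ?W = "jacobi_weight \<omega>" and ?M = "Suc (degree p)"
  define f where "f = jacobi_vec \<omega> p"
  have W: "0 \<le> ?W n" for n by (simp add: jacobi_weight_def assms prod_nonneg)
  have B: "0 \<le> B" using assms[of 0] by linarith
  have high: "f (Suc ?M) = 0" by (simp add: f_def jacobi_vec_eq_0)
  have deg: "degree ([:0, 1:] * p) \<le> ?M"
    by (cases "p = 0") auto
  have sq: "(a + b)\<^sup>2 \<le> 2 * a\<^sup>2 + 2 * b\<^sup>2" for a b :: real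
    using zero_le_power2[of "a - b"] by (simp add: power2_eq_square algebra_simps)
  have "jacobi_functional \<omega> (([:0, 1:] * p)\<^sup>2) = (\<Sum>n\<le>?M. ?W n * (jacobi \<omega> f n)\<^sup>2)"
    unfolding power2_eq_square jacobi_functional_mult[OF deg] jacobi_vec_x_mult f_def
    by (simp only: ac_simps)
  also have "\<dots> \<le> (\<Sum>n\<le>?M. 2 * (if n = 0 then 0 else B * (?W (n - 1) * (f (n - 1))\<^sup>2)) +
      2 * (B * (?W (Suc n) * (f (Suc n))\<^sup>2)))"
  proof (rule sum_mono)
    fix n
    let ?a = "if n = 0 then 0 else f (n - 1)" and ?b = "\<omega> (Suc n) * f (Suc n)"
    have "?W n * (jacobi \<omega> f n)\<^sup>2 \<le> ?W n * (2 * ?a\<^sup>2 + 2 * ?b\<^sup>2)"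
      unfolding jacobi_def by (intro mult_left_mono sq W)
    also have "\<dots> = 2 * (?W n * ?a\<^sup>2) + 2 * (?W n * ?b\<^sup>2)"
      by (simp add: algebra_simps)
    also have "?W n * ?a\<^sup>2 \<le> (if n = 0 then 0 else B * (?W (n - 1) * (f (n - 1))\<^sup>2))"
    proof (cases n)
      case (Suc m)
      have "\<omega> (Suc m) * (?W m * (f m)\<^sup>2) \<le> B * (?W m * (f m)\<^sup>2)"
        by (intro mult_right_mono assms mult_nonneg_nonneg W) simp
      then show ?thesis by (simp add: Suc ac_simps)
    qed simp
    also have "?W n * ?b\<^sup>2 \<le> B * (?W (Suc n) * (f (Suc n))\<^sup>2)"
    proof -
      have "\<omega> (Suc n) * (?W (Suc n) * (f (Suc n))\<^sup>2) \<le> B * (?W (Suc n) * (f (Suc n))\<^sup>2)"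
        by (intro mult_right_mono assms mult_nonneg_nonneg W) simp
      moreover have "?W n * ?b\<^sup>2 = \<omega> (Suc n) * (?W (Suc n) * (f (Suc n))\<^sup>2)"
        unfolding jacobi_weight_Suc power2_eq_square by (simp only: ac_simps)
      ultimately show ?thesis by (simp only:)
    qed
    finally show "?W n * (jacobi \<omega> f n)\<^sup>2 \<le> 2 * (if n = 0 then 0 else B * (?W (n - 1) * (f (n - 1))\<^sup>2)) +
      2 * (B * (?W (Suc n) * (f (Suc n))\<^sup>2))" by simp
  qed
  also have "\<dots> = 2 * (\<Sum>n\<le>?M. if n = 0 then 0 else B * (?W (n - 1) * (f (n - 1))\<^sup>2)) +
      2 * (\<Sum>n\<le>?M. B * (?W (Suc n) * (f (Suc n))\<^sup>2))"
    by (simp only: sum.distrib sum_distrib_left)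
  also have "(\<Sum>n\<le>?M. if n = 0 then 0 else B * (?W (n - 1) * (f (n - 1))\<^sup>2)) =
      B * (\<Sum>n\<le>degree p. ?W n * (f n)\<^sup>2)"
    by (subst sum.atMost_Suc_shift) (simp add: sum_distrib_left)
  also have "(\<Sum>n\<le>?M. B * (?W (Suc n) * (f (Suc n))\<^sup>2)) = B * (\<Sum>n\<le>?M. ?W (Suc n) * (f (Suc n))\<^sup>2)"
    by (simp only: sum_distrib_left)
  also have "(\<Sum>n\<le>?M. ?W (Suc n) * (f (Suc n))\<^sup>2) = (\<Sum>n\<le>Suc ?M. ?W n * (f n)\<^sup>2) - (f 0)\<^sup>2"
    by (subst (2) sum.atMost_Suc_shift) simp
  also have "(\<Sum>n\<le>Suc ?M. ?W n * (f n)\<^sup>2) = (\<Sum>n\<le>degree p. ?W n * (f n)\<^sup>2)"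
    using high by (simp add: f_def jacobi_vec_eq_0)
  also have "(\<Sum>n\<le>degree p. ?W n * (f n)\<^sup>2) = jacobi_functional \<omega> (p\<^sup>2)"
    unfolding power2_eq_square jacobi_functional_mult[OF order_refl] f_def by (simp only: ac_simps)
  also have "2 * (B * jacobi_functional \<omega> (p\<^sup>2)) + 2 * (B * (jacobi_functional \<omega> (p\<^sup>2) - (f 0)\<^sup>2))
      \<le> 4 * B * jacobi_functional \<omega> (p\<^sup>2)"
    using mult_nonneg_nonneg[OF B zero_le_power2[of "f 0"]] by (simp add: algebra_simps)
  finally show ?thesis by simp
qed

lemma jacobi_functional_square_nonneg:
  assumes "\<And>n. 0 \<le> \<omega> n"
  shows "0 \<le> jacobi_functional \<omega> (p\<^sup>2)"
  unfolding power2_eq_square jacobi_functional_mult[OF order_refl] jacobi_weight_def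
  by (intro sum_nonneg) (simp add: mult.assoc prod_nonneg assms)

lemma jacobi_functional_linear:
  "jacobi_functional \<omega> (p + q) = jacobi_functional \<omega> p + jacobi_functional \<omega> q"
  "jacobi_functional \<omega> (p - q) = jacobi_functional \<omega> p - jacobi_functional \<omega> q"
  "jacobi_functional \<omega> (smult c p) = c * jacobi_functional \<omega> p"
  by (simp_all add: jacobi_functional_def jacobi_vec_add jacobi_vec_diff jacobi_vec_smult)

text \<open>
  Even powers of \<open>R + x\<close> and \<open>R - x\<close> are absorbed into a square \<open>p\<^sup>2\<close>, which leaves the multipliers
  \<open>1\<close>, \<open>R \<plusminus> x\<close> and \<open>R\<^sup>2 - x\<^sup>2\<close>.  The last is the bound \<open>\<parallel>J\<parallel> \<le> R\<close>, and \<open>2R (R \<plusminus> x) = (R \<plusminus> x)\<^sup>2 + (R\<^sup>2 - x\<^sup>2)\<close>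
  reduces the middle ones to the other two.
\<close>

lemma jacobi_functional_interval_nonneg:
  assumes \<omega>: "\<And>n. 0 \<le> \<omega> n" "\<And>n. \<omega> n \<le> B" and R: "R > 0" "R\<^sup>2 = 4 * B"
  shows "0 \<le> jacobi_functional \<omega> ([:R, 1:] ^ k * [:R, -1:] ^ l)"
proof -
  let ?L = "jacobi_functional \<omega>"
  have both: "0 \<le> ?L ([:R, 1:] * [:R, -1:] * p\<^sup>2)" for p
  proof -
    have "[:R, 1:] * [:R, -1:] * p\<^sup>2 = smult (R\<^sup>2) (p\<^sup>2) - ([:0, 1:] * p)\<^sup>2"
      by (simp add: power2_eq_square algebra_simps)
    then show ?thesis
      using jacobi_functional_x_square_le[of \<omega> B p, OF \<omega>] by (simp only: jacobi_functional_linear R)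
  qed
  have one: "0 \<le> ?L ([:R, e:] * p\<^sup>2)" if e: "e = 1 \<or> e = -1" for e p
  proof -
    have "smult (2 * R) ([:R, e:] * p\<^sup>2) = ([:R, e:] * p)\<^sup>2 + [:R, 1:] * [:R, -1:] * p\<^sup>2"
    proof -
      have "smult (2 * R) [:R, e:] = [:R, e:]\<^sup>2 + [:R, 1:] * [:R, -1:]"
        using e by (auto simp: power2_eq_square)
      then have "smult (2 * R) [:R, e:] * p\<^sup>2 = ([:R, e:]\<^sup>2 + [:R, 1:] * [:R, -1:]) * p\<^sup>2" by (rule arg_cong)
      then show ?thesis by (simp only: mult_smult_left distrib_right power_mult_distrib)
    qed
    then have "2 * R * ?L ([:R, e:] * p\<^sup>2) = ?L (([:R, e:] * p)\<^sup>2) + ?L ([:R, 1:] * [:R, -1:] * p\<^sup>2)"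
      by (metis jacobi_functional_linear(1,3))
    also have "\<dots> \<ge> 0"
      by (intro add_nonneg_nonneg both jacobi_functional_square_nonneg \<omega>)
    finally show ?thesis using R by (simp add: zero_le_mult_iff)
  qed
  obtain i a where k: "k = i + 2 * a" "i = 0 \<or> i = 1"
    by (metis add.commute mod2_eq_if mult_div_mod_eq)
  obtain j b where l: "l = j + 2 * b" "j = 0 \<or> j = 1"
    by (metis add.commute mod2_eq_if mult_div_mod_eq)
  let ?p = "[:R, 1:] ^ a * [:R, -1:] ^ b"
  have "[:R, 1:] ^ k * [:R, -1:] ^ l = [:R, 1:] ^ i * [:R, -1:] ^ j * ?p\<^sup>2"
    unfolding k l power_add power_mult_distrib by (simp only: power_mult[symmetric] ac_simps)
  moreover have "0 \<le> ?L ([:R, 1:] ^ i * [:R, -1:] ^ j * ?p\<^sup>2)"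
    using k(2) l(2) both[of ?p] one[of 1 ?p] one[of "-1" ?p] jacobi_functional_square_nonneg[of \<omega> ?p, OF \<omega>(1)]
    by (elim disjE) (simp_all only: power_0 power_one_right mult_1_left mult_1_right mult.assoc simp_thms)
  ultimately show ?thesis by simp
qed

lemma integral_poly_eq_linear:
  fixes M :: "real measure" and \<Lambda> :: "real poly \<Rightarrow> real"
  assumes int: "\<And>k. integrable M (\<lambda>x. x ^ k)" and mom: "\<And>k. (\<integral>x. x ^ k \<partial>M) = \<Lambda> ([:0, 1:] ^ k)"
    and add: "\<And>p q. \<Lambda> (p + q) = \<Lambda> p + \<Lambda> q" and scale: "\<And>c p. \<Lambda> (smult c p) = c * \<Lambda> p"
  shows "integrable M (poly p)" "(\<integral>x. poly p x \<partial>M) = \<Lambda> p"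
proof -
  \<comment> \<open>The factor \<open>x\<^sup>k\<close> absorbs the \<open>x\<close> in \<open>pCons a p = a + x p\<close>.\<close>
  have "integrable M (\<lambda>x. x ^ k * poly p x) \<and> (\<integral>x. x ^ k * poly p x \<partial>M) = \<Lambda> ([:0, 1:] ^ k * p)" for k
  proof (induction p arbitrary: k)
    case 0
    show ?case using scale[of 0 0] by simp
  next
    case (pCons a p)
    have eq: "x ^ k * poly (pCons a p) x = a * x ^ k + x ^ Suc k * poly p x" for x :: real
      by (simp add: algebra_simps)
    have "[:0, 1:] ^ k * pCons a p = smult a ([:0, 1:] ^ k) + [:0, 1:] ^ Suc k * p"
      by (simp add: algebra_simps)
    then have "\<Lambda> ([:0, 1:] ^ k * pCons a p) = a * \<Lambda> ([:0, 1:] ^ k) + \<Lambda> ([:0, 1:] ^ Suc k * p)"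
      by (simp only: add scale)
    then show ?case
      unfolding eq using int[of k] mom[of k] pCons.IH[of "Suc k"] by simp
  qed
  from this[of 0] show "integrable M (poly p)" "(\<integral>x. poly p x \<partial>M) = \<Lambda> p" by simp_all
qed

text \<open>
  The analytic half of Favard's theorem, for bounded coefficients.  Under \<open>y = (R + x) / 2R\<close> the interval \<open>[-R, R]\<close> becomes
  \<open>[0, 1]\<close>, and the positivity of the functional on \<open>(R + x)\<^sup>k (R - x)\<^sup>l\<close> is the hypothesis of the
  Hausdorff moment theorem.  The measure obtained is moved back to \<open>[-R, R]\<close>.
\<close>

theorem Favard_measure:
  fixes \<omega> :: "nat \<Rightarrow> real"
  assumes \<omega>: "\<And>n. 0 \<le> \<omega> n" "\<And>n. \<omega> n \<le> B" and R: "R > 0" "R\<^sup>2 = 4 * B"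
  obtains M where "real_distribution M" "AE x in M. \<bar>x\<bar> \<le> R"
    "\<And>p. integrable M (poly p)" "\<And>p. (\<integral>x. poly p x \<partial>M) = jacobi_functional \<omega> p"
proof -
  let ?L = "jacobi_functional \<omega>"
  define y where "y = [:1 / 2, 1 / (2 * R):]"
  define y' where "y' = [:1 / 2, - 1 / (2 * R):]"
  define d where "d k l = ?L (y ^ k * y' ^ l)" for k l
  have y: "y = smult (1 / (2 * R)) [:R, 1:]" "y' = smult (1 / (2 * R)) [:R, -1:]"
    using R by (simp_all add: y_def y'_def)
  have "y + y' = 1" by (simp add: y_def y'_def one_pCons)
  have rec: "d k l = d (Suc k) l + d k (Suc l)" for k l
  proof -
    have "y ^ k * y' ^ l = (y + y') * (y ^ k * y' ^ l)" by (simp add: \<open>y + y' = 1\<close>)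
    also have "\<dots> = y ^ Suc k * y' ^ l + y ^ k * y' ^ Suc l" by (simp add: algebra_simps)
    finally show ?thesis by (simp only: d_def jacobi_functional_linear)
  qed
  have nonneg: "0 \<le> d k l" for k l
  proof -
    have "d k l = (1 / (2 * R)) ^ l * ((1 / (2 * R)) ^ k * ?L ([:R, 1:] ^ k * [:R, -1:] ^ l))"
      unfolding d_def y smult_power mult_smult_left mult_smult_right jacobi_functional_linear ..
    also have "\<dots> \<ge> 0"
      using R by (intro mult_nonneg_nonneg jacobi_functional_interval_nonneg[OF \<omega> R]) auto
    finally show ?thesis .
  qed
  have one: "d 0 0 = 1"
    by (simp add: d_def jacobi_functional_def jacobi_vec_1 unit_seq_def)
  obtain N where N: "real_distribution N" "AE x in N. x \<in> {0..1}"
    and mom: "\<And>k. (\<integral>x. x ^ k \<partial>N) = d k 0"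
    using Hausdorff_moment[of d, OF rec nonneg one] by blast
  interpret N: real_distribution N by fact
  have intN: "integrable N (\<lambda>x. x ^ k)" for k
    by (rule integrable_power_of_AE_bounded[OF N(1), of 1]) (use N(2) in \<open>eventually_elim, simp\<close>)
  have polyN: "integrable N (poly p) \<and> (\<integral>x. poly p x \<partial>N) = ?L (pcompose p y)" for p
  proof -
    have pow: "pcompose ([:0, 1:] ^ k) y = y ^ k" for k
      by (induction k) (simp_all add: pcompose_1 pcompose_mult pcompose_pCons)
    show ?thesis
      using integral_poly_eq_linear[of N "\<lambda>p. ?L (pcompose p y)" p, OF intN]
      by (simp add: mom d_def pow pcompose_add pcompose_smult jacobi_functional_linear)
  qed
  define M where "M = distr N borel (poly [:- R, 2 * R:])"
  have meas: "poly [:- R, 2 * R:] \<in> measurable N borel"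
    unfolding measurable_cong_sets[OF N.events_eq_borel refl]
    by (intro borel_measurable_continuous_onI continuous_intros)
  show ?thesis
  proof
    show "real_distribution M"
      unfolding M_def by (rule N.real_distribution_distr[OF meas])
    have "AE x in N. \<bar>poly [:- R, 2 * R:] x\<bar> \<le> R"
      using N(2)
    proof eventually_elim
      case (elim x)
      then have "R * x \<le> R * 1" "0 \<le> R * x" using R by (intro mult_left_mono, auto)
      then show ?case by (simp add: abs_le_iff algebra_simps)
    qed
    then show "AE x in M. \<bar>x\<bar> \<le> R"
      unfolding M_def by (subst AE_distr_iff[OF meas]) auto
    fix p :: "real poly"
    let ?q = "pcompose p [:- R, 2 * R:]"
    have q: "(\<lambda>x. poly p (poly [:- R, 2 * R:] x)) = poly ?q"
      by (simp add: fun_eq_iff poly_pcompose)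
    have "pcompose [:- R, 2 * R:] y = [:0, 1:]"
      using R by (simp add: y_def pcompose_pCons)
    then have "pcompose ?q y = p" by (simp add: pcompose_assoc[symmetric])
    then have "integrable N (poly ?q)" "(\<integral>x. poly ?q x \<partial>N) = ?L p"
      using polyN[of ?q] by simp_all
    moreover have "poly p \<in> borel_measurable borel"
      by (intro borel_measurable_continuous_onI continuous_intros)
    ultimately show "integrable M (poly p)" "(\<integral>x. poly p x \<partial>M) = ?L p"
      unfolding M_def by (simp_all only: integrable_distr_eq[OF meas] integral_distr[OF meas] q)
  qed
qed

locale jacobi_polynomials =
  fixes \<omega> :: "nat \<Rightarrow> real" and Q :: "nat \<Rightarrow> real poly"
  assumes Q_0: "Q 0 = 1"
    and x_Q: "[:0, 1:] * Q n = Q (Suc n) + (if n = 0 then 0 else smult (\<omega> n) (Q (n - 1)))"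
begin

lemma jacobi_vec_Q: "jacobi_vec \<omega> (Q n) = unit_seq n"
proof (induction n rule: less_induct)
  case (less n)
  show ?case
  proof (cases n)
    case 0
    then show ?thesis by (simp add: Q_0 jacobi_vec_1)
  next
    case (Suc m)
    have Q: "Q n = [:0, 1:] * Q m - (if m = 0 then 0 else smult (\<omega> m) (Q (m - 1)))"
      using x_Q[of m] Suc by (simp add: algebra_simps)
    have IH: "jacobi_vec \<omega> (Q m) = unit_seq m" "m \<noteq> 0 \<Longrightarrow> jacobi_vec \<omega> (Q (m - 1)) = unit_seq (m - 1)"
      using less.IH Suc by auto
    have "jacobi_vec \<omega> (Q n) = (\<lambda>k. jacobi \<omega> (unit_seq m) k - (if m = 0 then 0 else \<omega> m * unit_seq (m - 1) k))"
      unfolding Q jacobi_vec_diff jacobi_vec_x_mult IH(1)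
      by (cases "m = 0") (simp_all only: jacobi_vec_smult IH(2) simp_thms if_True if_False jacobi_vec_0)
    then show ?thesis by (simp add: jacobi_unit_seq Suc)
  qed
qed


lemma jacobi_functional_Q_mult:
  "jacobi_functional \<omega> (Q m * Q n) = (if m = n then jacobi_weight \<omega> n else 0)"
proof -
  have "jacobi_functional \<omega> (Q m * Q n) = (\<Sum>k\<le>degree (Q m) + m. jacobi_weight \<omega> k * unit_seq m k * unit_seq n k)"
    by (subst jacobi_functional_mult[of _ "degree (Q m) + m"]) (simp_all add: jacobi_vec_Q)
  also have "\<dots> = (\<Sum>k\<le>degree (Q m) + m. if k = m then (if m = n then jacobi_weight \<omega> n else 0) else 0)"
    by (intro sum.cong) (auto simp: unit_seq_def)
  finally show ?thesis by simp
qed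

text \<open>
  Orthogonality to \<open>Q\<^sub>0 = 1\<close> alone fixes all moments, since \<open>x\<^sup>k\<close> is a combination of the \<open>Q\<^sub>n\<close> whose
  coefficient at \<open>Q\<^sub>0\<close> is the \<open>k\<close>-th moment.
\<close>

lemma moments_of_Q:
  fixes M :: "real measure"
  assumes "\<And>n. integrable M (poly (Q n))" "\<And>n. (\<integral>x. poly (Q n) x \<partial>M) = (if n = 0 then 1 else 0)"
  shows "integrable M (\<lambda>x. x ^ k)" "(\<integral>x. x ^ k \<partial>M) = (jacobi \<omega> ^^ k) (unit_seq 0) 0"
proof -
  let ?c = "(jacobi \<omega> ^^ k) (unit_seq 0)"
  have iter: "((*) [:0, 1:] ^^ k) (Q 0) = [:0, 1:] ^ k"
    by (induction k) (simp_all add: Q_0)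
  have "((*) [:0, 1:] ^^ k) (Q 0) = (\<Sum>n\<le>k. smult (?c n) (Q n))"
    by (rule jacobi_iterate) (simp_all only: x_Q distrib_left mult_smult_right smult_add_left smult_add_right smult_smult smult_1_left)
  then have "poly ([:0, 1:] ^ k) x = poly (\<Sum>n\<le>k. smult (?c n) (Q n)) x" for x
    by (simp only: iter)
  then have p: "(\<lambda>x. x ^ k) = (\<lambda>x. \<Sum>n\<le>k. ?c n * poly (Q n) x)"
    by (simp add: fun_eq_iff poly_sum)
  show "integrable M (\<lambda>x. x ^ k)"
    unfolding p using assms(1) by (intro Bochner_Integration.integrable_sum integrable_mult_right)
  have "(\<integral>x. x ^ k \<partial>M) = (\<Sum>n\<le>k. ?c n * (\<integral>x. poly (Q n) x \<partial>M))"
    unfolding p using assms(1) by simp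
  also have "\<dots> = (\<Sum>n\<le>k. if n = 0 then ?c 0 else 0)"
    unfolding assms(2) by (intro sum.cong) auto
  finally show "(\<integral>x. x ^ k \<partial>M) = ?c 0" by simp
qed

end


section \<open>The Gaussian operator on the tensor powers of one vector\<close>

lemma op_tensor_add:
  assumes "is_linear S" "is_linear T"
  shows "op_tensor S T (F + G) = op_tensor S T F + op_tensor S T G"
proof (intro ext)
  fix xs ys
  have "(\<lambda>xs'. T ((F + G) xs') ys) = (\<lambda>xs'. T (F xs') ys) + (\<lambda>xs'. T (G xs') ys)"
    using assms(2) by (auto simp: is_linear_def fun_eq_iff)
  then show "op_tensor S T (F + G) xs ys = (op_tensor S T F + op_tensor S T G) xs ys"
    using assms(1) by (simp add: op_tensor_def is_linear_def)
qed

lemma op_tensor_scale: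
  assumes "is_linear S" "is_linear T"
  shows "op_tensor S T (scale2 c F) = scale2 c (op_tensor S T F)"
proof (intro ext)
  fix xs ys
  have row: "scale2 c F xs' = scale1 c (F xs')" for xs'
    by (simp add: fun_eq_iff scale1_def scale2_def)
  have "(\<lambda>xs'. T (scale2 c F xs') ys) = scale1 c (\<lambda>xs'. T (F xs') ys)"
    using assms(2) by (simp add: row is_linear_def) (simp add: scale1_def)
  then show "op_tensor S T (scale2 c F) xs ys = scale2 c (op_tensor S T F) xs ys"
    using assms(1) by (simp add: op_tensor_def is_linear_def) (simp add: op_tensor_def scale1_def scale2_def)
qed

lemma fscale_simps:
  "fscale c (f + g) = fscale c f + fscale c g" "fscale (a + b) f = fscale a f + fscale b f"
  "fscale a (fscale b f) = fscale (a * b) f" "fscale 1 f = f"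
  by (transfer; simp add: fun_eq_iff scale2_def algebra_simps)+

lemma fun_tensor_scale: "fun_tensor (scale1 a f) (scale1 b g) = scale2 (a * b) (fun_tensor f g)"
  by (simp add: fun_eq_iff fun_tensor_def scale1_def scale2_def)

lemma gauss_op_add: "gauss_op q t v w \<xi> \<eta> (f + g) = gauss_op q t v w \<xi> \<eta> f + gauss_op q t v w \<xi> \<eta> g"
proof -
  have "annih_dig q t v w \<xi> \<eta> (f + g) = annih_dig q t v w \<xi> \<eta> f + annih_dig q t v w \<xi> \<eta> g"
    by transfer (simp add: op_tensor_add is_linear_annih)
  moreover have "creat_dig \<xi> \<eta> (f + g) = creat_dig \<xi> \<eta> f + creat_dig \<xi> \<eta> g"
    by transfer (simp add: op_tensor_add is_linear_creat)
  ultimately show ?thesis by (simp add: gauss_op_def)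
qed

lemma gauss_op_scale: "gauss_op q t v w \<xi> \<eta> (fscale c f) = fscale c (gauss_op q t v w \<xi> \<eta> f)"
proof -
  have "annih_dig q t v w \<xi> \<eta> (fscale c f) = fscale c (annih_dig q t v w \<xi> \<eta> f)"
    by transfer (simp add: op_tensor_scale is_linear_annih)
  moreover have "creat_dig \<xi> \<eta> (fscale c f) = fscale c (creat_dig \<xi> \<eta> f)"
    by transfer (simp add: op_tensor_scale is_linear_creat)
  ultimately show ?thesis by (simp add: gauss_op_def fscale_simps)
qed

definition power_tensor :: "'h \<Rightarrow> 'k \<Rightarrow> nat \<Rightarrow> ('h::real_inner, 'k::real_inner) fock_dig" where
  "power_tensor \<xi> \<eta> n = elem_tensor (replicate n (of_re \<xi>)) (replicate n (of_re \<eta>))"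

lemma functional_power_tensor:
  "functional (power_tensor \<xi> \<eta> n) = fun_tensor (etensor (replicate n (of_re \<xi>))) (etensor (replicate n (of_re \<eta>)))"
  by (simp add: power_tensor_def elem_tensor.rep_eq)

lemma cinner_of_re_self: "cinner (of_re \<xi>) (of_re \<xi>) = of_real ((norm \<xi>)\<^sup>2)"
  by (simp add: cinner_self of_re_def)

text \<open>
  All \<open>n\<close> omissions give the same tensor \<open>\<xi>\<^bsup>\<otimes>(n-1)\<^esup>\<close>, so their coefficients add up to \<open>[n]\<^bsub>q,t\<^esub>\<close>.
\<close>

lemma annih_power:
  "annih q t \<xi> (etensor (replicate n (of_re \<xi>))) =
     scale1 (of_real (qt_num n q t * (norm \<xi>)\<^sup>2)) (etensor (replicate (n - 1) (of_re \<xi>)))"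
proof (rule ext)
  fix xs
  let ?x = "of_re \<xi>"
  have "annih q t \<xi> (etensor (replicate n ?x)) xs = (\<Sum>i<n. of_real (q ^ i * t ^ (n - 1 - i)) * cinner ?x (replicate n ?x ! i) *
            etensor (take i (replicate n ?x) @ drop (Suc i) (replicate n ?x)) xs)"
    unfolding annih_etensor by simp
  also have "\<dots> = (\<Sum>i<n. of_real (q ^ i * t ^ (n - 1 - i)) * of_real ((norm \<xi>)\<^sup>2) * etensor (replicate (n - 1) ?x) xs)"
  proof (rule sum.cong)
    fix i assume i: "i \<in> {..<n}"
    then have "take i (replicate n ?x) @ drop (Suc i) (replicate n ?x) = replicate (n - 1) ?x"
      by (simp add: replicate_add[symmetric])
    then show "of_real (q ^ i * t ^ (n - 1 - i)) * cinner ?x (replicate n ?x ! i) *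
            etensor (take i (replicate n ?x) @ drop (Suc i) (replicate n ?x)) xs =
        of_real (q ^ i * t ^ (n - 1 - i)) * of_real ((norm \<xi>)\<^sup>2) * etensor (replicate (n - 1) ?x) xs"
      using i by (simp add: cinner_of_re_self)
  qed simp
  also have "\<dots> = scale1 (of_real (qt_num n q t * (norm \<xi>)\<^sup>2)) (etensor (replicate (n - 1) ?x)) xs"
    by (simp add: scale1_def qt_num_def sum_distrib_right)
  finally show "annih q t \<xi> (etensor (replicate n ?x)) xs =
     scale1 (of_real (qt_num n q t * (norm \<xi>)\<^sup>2)) (etensor (replicate (n - 1) ?x)) xs" .
qed

lemma creat_dig_power_tensor: "creat_dig \<xi> \<eta> (power_tensor \<xi> \<eta> n) = power_tensor \<xi> \<eta> (Suc n)"
  by (simp add: functional_inject[symmetric] creat_dig.rep_eq functional_power_tensor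
      op_tensor_fun_tensor is_linear_creat creat_etensor)

lemma annih_dig_power_tensor:
  assumes "norm \<xi> * norm \<eta> = 1"
  shows "annih_dig q t v w \<xi> \<eta> (power_tensor \<xi> \<eta> n) =
           fscale (of_real (qt_num n q t * qt_num n v w)) (power_tensor \<xi> \<eta> (n - 1))"
proof -
  have "qt_num n q t * (norm \<xi>)\<^sup>2 * (qt_num n v w * (norm \<eta>)\<^sup>2) = qt_num n q t * qt_num n v w * (norm \<xi> * norm \<eta>)\<^sup>2"
    by (simp only: power_mult_distrib ac_simps)
  then show ?thesis
    by (simp only: fun_tensor_scale functional_inject[symmetric] annih_dig.rep_eq functional_power_tensor fscale.rep_eq
      op_tensor_fun_tensor is_linear_annih annih_power of_real_mult[symmetric] assms power_one mult_1_right)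
qed

lemma functional_sum: "functional (sum f A) xs ys = (\<Sum>a\<in>A. functional (f a) xs ys)"
  by (induction A rule: infinite_finite_induct) (auto simp: zero_fock_dig.rep_eq plus_fock_dig.rep_eq)

text \<open>
  In degree 0 the symmetrisation operators are the identity.
\<close>

lemma quad_form_vacuum: "quad_form q t v w vacuum g = functional g [] []"
proof -
  have "{\<sigma>. \<sigma> = id} = {id :: nat \<Rightarrow> nat}" by auto
  then have sym: "sym_op a b f [] = f []" for a b and f :: "'c cplx list \<Rightarrow> complex"
    by (simp add: sym_op_def inversions_def binomial_eq_0)
  show ?thesis
    by (simp add: quad_form_def vacuum_def fock_inner_elem_left sym_dig.rep_eq op_tensor_def sym)
qed

text \<open>
  The vacuum generates, under the Gaussian operator, only the tensors \<open>\<xi>\<^bsup>\<otimes>n\<^esup> \<otimes> \<eta>\<^bsup>\<otimes>n\<^esup>\<close>, on which the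
  operator acts by the three-term recurrence; among these only \<open>n = 0\<close> is seen by the vacuum state.
\<close>

lemma vacuum_state_gauss_power:
  assumes "norm \<xi> * norm \<eta> = 1"
  shows "vacuum_state q t v w (gauss_op q t v w \<xi> \<eta> ^^ k) =
    of_real ((jacobi (\<lambda>n. qt_num n q t * qt_num n v w) ^^ k) (unit_seq 0) 0)"
proof -
  let ?\<omega> = "\<lambda>n. qt_num n q t * qt_num n v w" and ?G = "gauss_op q t v w \<xi> \<eta>"
  let ?c = "(jacobi ?\<omega> ^^ k) (unit_seq 0)"
  have G: "?G (power_tensor \<xi> \<eta> n) = power_tensor \<xi> \<eta> (Suc n) +
      (if n = 0 then 0 else fscale (of_real (?\<omega> n)) (power_tensor \<xi> \<eta> (n - 1)))" for n
  proof -
    have "fscale 0 f = 0" for f :: "('a, 'b) fock_dig"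
      using fscale_simps(2)[of 0 0 f] by simp
    then show ?thesis
      by (simp add: gauss_op_def annih_dig_power_tensor[OF assms] creat_dig_power_tensor qt_num_def add.commute)
  qed
  have "(?G ^^ k) (power_tensor \<xi> \<eta> 0) = (\<Sum>n\<le>k. fscale (of_real (?c n)) (power_tensor \<xi> \<eta> n))"
    by (rule jacobi_iterate[where s = "\<lambda>c. fscale (of_real c)"])
      (simp_all only: gauss_op_add gauss_op_scale fscale_simps of_real_add of_real_mult of_real_1 G)
  moreover have "vacuum = power_tensor \<xi> \<eta> 0" by (simp add: vacuum_def power_tensor_def)
  ultimately have "vacuum_state q t v w (?G ^^ k) = (\<Sum>n\<le>k. of_real (?c n) * functional (power_tensor \<xi> \<eta> n) [] [])"
    by (simp add: vacuum_state_def quad_form_vacuum functional_sum fscale.rep_eq scale2_def)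
  also have "\<dots> = (\<Sum>n\<le>k. if n = 0 then of_real (?c 0) else 0)"
    by (intro sum.cong) (auto simp: functional_power_tensor fun_tensor_def etensor_def)
  finally show ?thesis by simp
qed

section \<open>Bounds for the two-parameter integers\<close>

text \<open>
  For \<open>q < 0\<close> the sum has terms of both signs, but \<open>(t - q) [n]\<^bsub>q,t\<^esub> = t\<^sup>n - q\<^sup>n\<close>.
\<close>

lemma qt_num_nonneg:
  assumes "\<bar>q\<bar> \<le> t"
  shows "0 \<le> qt_num n q t"
proof (cases "0 \<le> q")
  case True
  then show ?thesis using assms by (auto simp: qt_num_def intro!: sum_nonneg)
next
  case False
  show ?thesis
  proof (cases n)
    case 0
    then show ?thesis by (simp add: qt_num_def)
  next
    case (Suc m)
    have "q ^ n \<le> \<bar>q\<bar> ^ n" by (metis abs_ge_self power_abs)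
    also have "\<dots> \<le> t ^ n" using assms by (intro power_mono) auto
    finally have "0 \<le> t ^ n - q ^ n" by simp
    also have "t ^ n - q ^ n = (t - q) * qt_num n q t"
      using power_diff_sumr2[of q n t] by (simp add: qt_num_def Suc algebra_simps)
    finally show ?thesis using False assms by (simp add: zero_le_mult_iff)
  qed
qed

lemma qt_num_le:
  assumes "\<bar>q\<bar> < 1" "\<bar>q\<bar> \<le> t" "t \<le> 1"
  shows "qt_num n q t \<le> 1 / (1 - \<bar>q\<bar>)"
proof -
  have "qt_num n q t \<le> (\<Sum>k<n. \<bar>q\<bar> ^ k)"
    unfolding qt_num_def
  proof (rule sum_mono)
    fix k
    have "q ^ k * t ^ (n - 1 - k) \<le> \<bar>q\<bar> ^ k * t ^ (n - 1 - k)"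
      using assms by (intro mult_right_mono) (auto simp: power_abs[symmetric])
    also have "\<dots> \<le> \<bar>q\<bar> ^ k * 1"
      using assms by (intro mult_left_mono power_le_one) auto
    finally show "q ^ k * t ^ (n - 1 - k) \<le> \<bar>q\<bar> ^ k" by simp
  qed
  also have "\<dots> \<le> (\<Sum>k. \<bar>q\<bar> ^ k)"
    using assms by (intro sum_le_suminf) (auto intro: summable_geometric)
  also have "\<dots> = 1 / (1 - \<bar>q\<bar>)"
    using assms by (intro suminf_geometric) simp
  finally show ?thesis .
qed

lemma jacobi_polynomials_quad_poly:
  "jacobi_polynomials (\<lambda>n. qt_num n q t * qt_num n v w) (quad_poly q t v w)"
proof
  show "quad_poly q t v w 0 = 1" by (simp add: quad_poly_def)
  show "[:0, 1:] * quad_poly q t v w n = quad_poly q t v w (Suc n) +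
      (if n = 0 then 0 else smult (qt_num n q t * qt_num n v w) (quad_poly q t v w (n - 1)))" for n
    by (cases n) (simp_all add: quad_poly_def)
qed

section \<open>The distribution of the Gaussian operator\<close>

theorem theorem4p3:
  fixes \<xi> :: "'h :: {real_inner, polish_space}"
    and \<eta> :: "'k :: {real_inner, polish_space}"
    and q t v w :: real
  assumes "-1 < q" "q < 1" "-1 < v" "v < 1"
    and "\<bar>q\<bar> \<le> t" "t \<le> 1" "\<bar>v\<bar> \<le> w" "w \<le> 1"
    and "fock_norm (elem_tensor [of_re \<xi>] [of_re \<eta>]) = 1"
  shows "(\<exists>!\<kappa>. is_vacuum_distribution q t v w (gauss_op q t v w \<xi> \<eta>) \<kappa>) \<and>
         (\<exists>!\<mu>. is_quad_measure q t v w \<mu>) \<and>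
         vacuum_distribution q t v w (gauss_op q t v w \<xi> \<eta>) = quad_measure q t v w"
proof -
  let ?G = "gauss_op q t v w \<xi> \<eta>" and ?Q = "quad_poly q t v w"
  define \<omega> where "\<omega> n = qt_num n q t * qt_num n v w" for n
  define m where "m k = (jacobi \<omega> ^^ k) (unit_seq 0) 0" for k
  define B where "B = 1 / (1 - \<bar>q\<bar>) * (1 / (1 - \<bar>v\<bar>))"
  interpret jacobi_polynomials \<omega> ?Q
    unfolding \<omega>_def[abs_def] by (rule jacobi_polynomials_quad_poly)
  have q: "\<bar>q\<bar> < 1" and v: "\<bar>v\<bar> < 1" using assms by auto
  have \<omega>: "0 \<le> \<omega> n" "\<omega> n \<le> B" for n
  proof -
    show "0 \<le> \<omega> n"
      unfolding \<omega>_def using assms by (intro mult_nonneg_nonneg qt_num_nonneg)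
    show "\<omega> n \<le> B"
      unfolding \<omega>_def B_def using assms q v by (intro mult_mono qt_num_le qt_num_nonneg) auto
  qed
  have "B > 0" using q v by (simp add: B_def)
  then have R: "2 * sqrt B > 0" "(2 * sqrt B)\<^sup>2 = 4 * B" by (simp_all add: power_mult_distrib)
  obtain M where M: "real_distribution M" "AE x in M. \<bar>x\<bar> \<le> 2 * sqrt B"
    and int: "\<And>p. integrable M (poly p)" and L: "\<And>p. (\<integral>x. poly p x \<partial>M) = jacobi_functional \<omega> p"
    by (rule Favard_measure[of \<omega> B "2 * sqrt B", OF \<omega> R]) (rule that)
  have momM: "(\<integral>x. x ^ k \<partial>M) = m k" for k
    using L[of "[:0, 1:] ^ k"] by (simp add: jacobi_functional_def jacobi_vec_x_power m_def)
  have unique: "N = M" if N: "real_distribution N" "\<And>k. integrable N (\<lambda>x. x ^ k)" "\<And>k. (\<integral>x. x ^ k \<partial>N) = m k" for N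
    using bounded_moments_imp_equal[OF M(1) N(1) integrable_power_of_AE_bounded[OF M] N(2) _ integral_even_power_le[OF M]]
      N(3) momM by simp
  have "norm (of_re \<xi>) * norm (of_re \<eta>) = 1"
    using assms(9) by (simp only: fock_norm_elem_tensor)
  then have norm1: "norm \<xi> * norm \<eta> = 1" by (simp add: of_re_def)
  have vac: "vacuum_state q t v w (?G ^^ k) = of_real (m k)" for k
    using vacuum_state_gauss_power[OF norm1] by (simp add: m_def \<omega>_def[abs_def])

  have "is_vacuum_distribution q t v w ?G M"
    unfolding is_vacuum_distribution_def
  proof (intro conjI allI exI)
    show "compact {- (2 * sqrt B)..2 * sqrt B}" by simp
    show "AE x in M. x \<in> {- (2 * sqrt B)..2 * sqrt B}"
      using M(2) by eventually_elim (simp add: abs_le_iff)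
  qed (simp_all add: M vac momM)
  moreover have "\<kappa> = M" if \<kappa>: "is_vacuum_distribution q t v w ?G \<kappa>" for \<kappa>
  proof (rule unique)
    show rd: "real_distribution \<kappa>" using \<kappa> by (simp add: is_vacuum_distribution_def)
    obtain K where K: "compact K" "AE x in \<kappa>. x \<in> K" using \<kappa> by (auto simp: is_vacuum_distribution_def)
    obtain r where "\<And>x. x \<in> K \<Longrightarrow> \<bar>x\<bar> \<le> r"
      using compact_imp_bounded[OF K(1)] by (auto simp: bounded_real)
    then have "AE x in \<kappa>. \<bar>x\<bar> \<le> r" using K(2) by (auto elim: eventually_mono)
    then show "integrable \<kappa> (\<lambda>x. x ^ k)" for k by (rule integrable_power_of_AE_bounded[OF rd])
    show "(\<integral>x. x ^ k \<partial>\<kappa>) = m k" for k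
    proof -
      have "complex_of_real (\<integral>x. x ^ k \<partial>\<kappa>) = of_real (m k)"
        using \<kappa> by (simp add: is_vacuum_distribution_def vac)
      then show ?thesis by (simp only: of_real_eq_iff)
    qed
  qed
  ultimately have \<kappa>: "\<exists>!\<kappa>. is_vacuum_distribution q t v w ?G \<kappa>" "vacuum_distribution q t v w ?G = M"
    unfolding vacuum_distribution_def by (blast, blast intro: the_equality)

  have "is_quad_measure q t v w M"
    unfolding is_quad_measure_def orthogonalizes_def
  proof (intro conjI allI)
    fix m n
    show "integrable M (\<lambda>x. poly (?Q m) x * poly (?Q n) x)"
      unfolding poly_mult[symmetric] by (rule int)
    show "(\<integral>x. poly (?Q m) x * poly (?Q n) x \<partial>M) = (if m = n then \<Prod>k=1..n. qt_num k q t * qt_num k v w else 0)"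
      using L[of "?Q m * ?Q n"] by (simp add: jacobi_functional_Q_mult jacobi_weight_def \<omega>_def)
  qed (rule M)
  moreover have "\<mu> = M" if \<mu>: "is_quad_measure q t v w \<mu>" for \<mu>
  proof (rule unique)
    show "real_distribution \<mu>" using \<mu> by (simp add: is_quad_measure_def)
    have "integrable \<mu> (\<lambda>x. poly (?Q n) x * poly (?Q 0) x)"
      "(\<integral>x. poly (?Q n) x * poly (?Q 0) x \<partial>\<mu>) = (if n = 0 then 1 else 0)" for n
      using \<mu> by (simp_all add: is_quad_measure_def orthogonalizes_def)
    then have Q: "integrable \<mu> (poly (?Q n))" "(\<integral>x. poly (?Q n) x \<partial>\<mu>) = (if n = 0 then 1 else 0)" for n
      by (simp_all add: Q_0)
    show "integrable \<mu> (\<lambda>x. x ^ k)" "(\<integral>x. x ^ k \<partial>\<mu>) = m k" for k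
      using moments_of_Q[of \<mu>, OF Q] by (simp_all add: m_def)
  qed
  ultimately have \<mu>: "\<exists>!\<mu>. is_quad_measure q t v w \<mu>" "quad_measure q t v w = M"
    unfolding quad_measure_def by (blast, blast intro: the_equality)
  show ?thesis using \<kappa> \<mu> by simp
qed

end
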